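(* Fix integers $d\ge2$, $r\ge1$ and a constant $M>0$. There exist constants $C_1,C_2,c>0$ depending only on $d,r,M$ such that the following holds for all sufficiently large $n$. Let $H$ be a Hermitian operator on $(\mathbb C^d)^{\otimes n}$ with $H\mathcal T=\mathcal TH$ and non-degenerate spectrum, and let $A$ be a traceless $r$-local operator (not necessarily Hermitian) with $\|A\|\le M$. For a state $|\psi\rangle$ define $$A^\infty_\psi:=\lim_{\tau\to\infty}\frac1\tau\int_0^\tau\langle\psi|e^{iHt}Ae^{-iHt}|\psi\rangle\,dt.$$ Then $\mathbb E_{\psi\in P}|A^\infty_\psi|\le C_1/\sqrt n$, and for every $\delta\ge C_2\sqrt{(\log n)/n}$, $$\Pr_{\psi\in P}\big(|A^\infty_\psi|\ge\delta\big)\le e^{-c n\delta^2}.$$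
   Context: $\mathcal T$ is the unitary lattice translation operator on $(\mathbb C^d)^{\otimes n}$, defined on computational basis states by $\mathcal T(|x_1\rangle\otimes\cdots\otimes|x_n\rangle)=|x_n\rangle\otimes|x_1\rangle\otimes\cdots\otimes|x_{n-1}\rangle$. An operator is $r$-local if it acts nontrivially only on at most $r$ cyclically consecutive sites. A spectrum is non-degenerate if all eigenvalues are distinct. A random product state is $|\psi\rangle=\bigotimes_{l=1}^n|\psi_l\rangle$ where each $|\psi_l\rangle\in\mathbb C^d$ is chosen independently and uniformly (Haar) at random; $\mathbb E_{\psi\in P}$ and $\Pr_{\psi\in P}$ denote expectation and probability over this distribution. *)

theory Defs
  imports "HOL-Probability.Probability" "Jordan_Normal_Form.Char_Poly"
begin

text \<open>Operators on (C^d)^{\<otimes>n} are complex (d^n x d^n) matrices.  Basis index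
  i < d^n encodes the configuration (x_0,...,x_{n-1}) with x_l = digit d n i l,
  site 0 being the most significant (leftmost) tensor factor.\<close>

definition digit :: "nat \<Rightarrow> nat \<Rightarrow> nat \<Rightarrow> nat \<Rightarrow> nat" where
  "digit d n i l = (i div d ^ (n - 1 - l)) mod d"

text \<open>Lattice translation: T |x_0,...,x_{n-1}> = |x_{n-1},x_0,...,x_{n-2}>.\<close>
definition transl :: "nat \<Rightarrow> nat \<Rightarrow> complex mat" where
  "transl d n = mat (d ^ n) (d ^ n) (\<lambda>(i, j).
     if (\<forall>l<n. digit d n i l = digit d n j ((l + n - 1) mod n)) then 1 else 0)"

definition hermitian_mat :: "complex mat \<Rightarrow> bool" where
  "hermitian_mat H \<longleftrightarrow> dim_row H = dim_col H \<and>
     (\<forall>i<dim_row H. \<forall>j<dim_col H. H $$ (j, i) = cnj (H $$ (i, j)))"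

definition nondegenerate_spectrum :: "complex mat \<Rightarrow> bool" where
  "nondegenerate_spectrum H \<longleftrightarrow> (\<forall>k. order k (char_poly H) \<le> 1)"

definition mat_trace :: "complex mat \<Rightarrow> complex" where
  "mat_trace A = (\<Sum>i<dim_row A. A $$ (i, i))"

definition vnorm :: "complex vec \<Rightarrow> real" where
  "vnorm v = sqrt (\<Sum>i<dim_vec v. (cmod (v $ i))\<^sup>2)"

definition op_norm :: "complex mat \<Rightarrow> real" where
  "op_norm A = Sup {vnorm (A *\<^sub>v v) | v. v \<in> carrier_vec (dim_col A) \<and> vnorm v \<le> 1}"

text \<open>A acts nontrivially only on the r cyclically consecutive sites
  s, s+1, ..., s+r-1 (mod n), for some s: A = B \<otimes> Id.\<close>
definition r_local :: "nat \<Rightarrow> nat \<Rightarrow> nat \<Rightarrow> complex mat \<Rightarrow> bool" where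
  "r_local d n r A \<longleftrightarrow> (\<exists>s<n. \<exists>b :: (nat \<Rightarrow> nat) \<Rightarrow> (nat \<Rightarrow> nat) \<Rightarrow> complex.
     (\<forall>i<d ^ n. \<forall>j<d ^ n. A $$ (i, j) =
        (if (\<forall>l<n. l \<notin> {(s + k) mod n | k. k < r} \<longrightarrow> digit d n i l = digit d n j l)
         then b (restrict (\<lambda>k. digit d n i ((s + k) mod n)) {..<r})
                (restrict (\<lambda>k. digit d n j ((s + k) mod n)) {..<r})
         else 0)))"

definition mat_exp :: "complex mat \<Rightarrow> complex mat" where
  "mat_exp M = mat (dim_row M) (dim_col M)
     (\<lambda>(i, j). \<Sum>k. (M ^\<^sub>m k) $$ (i, j) / of_nat (fact k))"

definition expval :: "complex vec \<Rightarrow> complex mat \<Rightarrow> complex" where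
  "expval v X = (\<Sum>i<dim_vec v. \<Sum>j<dim_vec v. cnj (v $ i) * X $$ (i, j) * v $ j)"

definition time_avg :: "complex mat \<Rightarrow> complex mat \<Rightarrow> complex vec \<Rightarrow> complex" where
  "time_avg H A v = Lim at_top (\<lambda>\<tau>::real. complex_of_real (1 / \<tau>) *
     integral {0..\<tau>} (\<lambda>t. expval v (mat_exp (complex_of_real t * \<i> \<cdot>\<^sub>m H) * A
                                  * mat_exp (- (complex_of_real t * \<i>) \<cdot>\<^sub>m H))))"

text \<open>Haar-random unit vector in C^d, realised as a normalised standard complex
  Gaussian vector (the standard construction of the unitarily invariant measure).\<close>
definition cgauss :: "complex measure" where
  "cgauss = density lborel (\<lambda>z. ennreal (exp (- (cmod z)\<^sup>2) / pi))"

definition haar_site :: "nat \<Rightarrow> (nat \<Rightarrow> complex) measure" where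
  "haar_site d = distr (PiM {..<d} (\<lambda>_. cgauss)) (PiM {..<d} (\<lambda>_. borel))
     (\<lambda>g. restrict (\<lambda>j. g j / complex_of_real (sqrt (\<Sum>k<d. (cmod (g k))\<^sup>2))) {..<d})"

definition prod_measure :: "nat \<Rightarrow> nat \<Rightarrow> (nat \<Rightarrow> nat \<Rightarrow> complex) measure" where
  "prod_measure d n = PiM {..<n} (\<lambda>_. haar_site d)"

definition prod_state :: "nat \<Rightarrow> nat \<Rightarrow> (nat \<Rightarrow> nat \<Rightarrow> complex) \<Rightarrow> complex vec" where
  "prod_state d n \<phi> = vec (d ^ n) (\<lambda>i. \<Prod>l<n. \<phi> l (digit d n i l))"

end

theory Submission
  imports Defs "Jordan_Normal_Form.Schur_Decomposition"
begin

text \<open>Let \<open>u\<^sub>k\<close> be an eigenbasis of \<open>H\<close>.  As the spectrum is simple, the time average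
  equals \<open>\<Sum>\<^sub>k p\<^sub>k a\<^sub>k\<close> with \<open>p\<^sub>k = |\<langle>u\<^sub>k|\<psi>\<rangle>|\<^sup>2\<close> and \<open>a\<^sub>k = \<langle>u\<^sub>k|A|u\<^sub>k\<rangle>\<close>, and each \<open>u\<^sub>k\<close> is also an
  eigenvector of the translation.  Hence \<open>a\<^sub>k\<close> does not change when \<open>A\<close> is moved along the chain, and
  it is the average of the expectations of the copies of \<open>A\<close> on \<open>m = n div r\<close> disjoint blocks.  After
  rotating \<open>A\<close> by a phase and passing to Hermitian parts, these copies are diagonal in a common product
  basis.  Jensen's inequality and independence of the blocks bound the exponential moments of \<open>k \<mapsto> a\<^sub>k\<close>
  under the uniform distribution by those of a mean of \<open>m\<close> independent centred bounded variables.
  Since \<open>E p\<^sub>k \<le> d\<^sup>-\<^sup>n\<close>, a second use of Jensen's inequality and Markov's inequality finish the proof.\<close>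

section \<open>The spectral theorem for Hermitian matrices\<close>

text \<open>The smallness does not come from cancellations in the random state. Nearly all
  eigenvectors have a small a_k, and a random product state cannot favour the exceptional ones,
  because its mean density matrix is at most d^-n times the identity. Simplicity of the spectrum
  enters twice: it kills the terms with k different from l in the time average, and it makes
  translation act on each eigenvector by a phase. Copies of A at neighbouring positions need not
  commute; copies on disjoint blocks do, and there are still about n / r of them. This gives
  exponential moments exp (x^2 V) with V of order 1/n, from which all constants are read off: x = 1
  / sqrt V serves the mean, x proportional to \<delta> / V the tail. Complex values are handled
  through the four phases 1, -1, i, -i. Normalisation maps the zero vector to 0, so the weights are
  only known to have total at most 1. The missing mass costs a factor 2 and the four phases a factor
  4; the lower bound on \<delta> lets half of the exponent absorb the resulting 8.\<close>

definition orthonormal_basis :: "nat \<Rightarrow> (nat \<Rightarrow> nat \<Rightarrow> complex) \<Rightarrow> bool" where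
  "orthonormal_basis N u \<longleftrightarrow>
     (\<forall>k<N. \<forall>l<N. (\<Sum>i<N. cnj (u k i) * u l i) = (if k = l then 1 else 0)) \<and>
     (\<forall>i<N. \<forall>j<N. (\<Sum>k<N. u k i * cnj (u k j)) = (if i = j then 1 else 0))"

definition spectral_decomposition ::
  "nat \<Rightarrow> (nat \<Rightarrow> nat \<Rightarrow> complex) \<Rightarrow> (nat \<Rightarrow> nat \<Rightarrow> complex) \<Rightarrow> (nat \<Rightarrow> real) \<Rightarrow> bool" where
  "spectral_decomposition N h u eig \<longleftrightarrow> orthonormal_basis N u \<and>
     (\<forall>i<N. \<forall>j<N. h i j = (\<Sum>k<N. of_real (eig k) * (u k i * cnj (u k j))))"

text \<open>Schur triangularisation: \<open>es\<close> is the diagonal of a triangular matrix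
  similar to \<open>g\<close>, so it lists the eigenvalues with multiplicity and sums to the trace.
  The sum is what later allows an eigenvalue to be located by counting.\<close>

lemma eigenvalues_with_trace:
  fixes g :: "nat \<Rightarrow> nat \<Rightarrow> complex"
  obtains es where "length es = N" "sum_list es = (\<Sum>i<N. g i i)"
    "\<And>e. e \<in> set es \<Longrightarrow> \<exists>w. (\<exists>i<N. w i \<noteq> 0) \<and> (\<forall>i<N. (\<Sum>j<N. g i j * w j) = e * w i)"
proof -
  define A where "A = mat N N (\<lambda>(i, j). g i j)"
  have A: "A \<in> carrier_mat N N" by (simp add: A_def)
  obtain es where es: "char_poly A = (\<Prod>a\<leftarrow>es. [:- a, 1:])" "length es = N"
    using char_poly_factorized[OF A] by blast
  obtain B P Q where "schur_decomposition A es = (B, P, Q)"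
    by (cases "schur_decomposition A es") auto
  with schur_decomposition[OF A es(1)]
  have sim: "similar_mat_wit A B P Q" and diag: "diag_mat B = es" by auto
  have carr: "B \<in> carrier_mat N N" "P \<in> carrier_mat N N" "Q \<in> carrier_mat N N"
    and QP: "Q * P = 1\<^sub>m N" and APQ: "A = P * B * Q"
    using similar_mat_witD2[OF A sim] by simp_all
  \<comment> \<open>Cyclicity of the trace, tr (P B Q) = tr (B Q P) with Q P = 1, written out in
    sums.\<close>
  have "(\<Sum>i<N. g i i) = (\<Sum>i<N. A $$ (i, i))" by (simp add: A_def)
  also have "\<dots> = (\<Sum>i<N. \<Sum>k<N. (P * B) $$ (i, k) * Q $$ (k, i))"
    using carr by (auto simp: APQ scalar_prod_def atLeast0LessThan simp del: assoc_mult_mat intro!: sum.cong)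
  also have "\<dots> = (\<Sum>i<N. \<Sum>k<N. \<Sum>l<N. P $$ (i, l) * B $$ (l, k) * Q $$ (k, i))"
    using carr by (auto simp: scalar_prod_def atLeast0LessThan sum_distrib_right intro!: sum.cong)
  also have "\<dots> = (\<Sum>k<N. \<Sum>i<N. \<Sum>l<N. P $$ (i, l) * B $$ (l, k) * Q $$ (k, i))"
    by (rule sum.swap)
  also have "\<dots> = (\<Sum>k<N. \<Sum>l<N. \<Sum>i<N. P $$ (i, l) * B $$ (l, k) * Q $$ (k, i))"
    by (rule sum.cong[OF refl], rule sum.swap)
  also have "\<dots> = (\<Sum>k<N. \<Sum>l<N. B $$ (l, k) * (Q * P) $$ (k, l))"
    using carr by (auto simp: scalar_prod_def atLeast0LessThan sum_distrib_left algebra_simps intro!: sum.cong)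
  also have "\<dots> = (\<Sum>k<N. \<Sum>l<N. if l = k then B $$ (k, k) else 0)"
    by (intro sum.cong refl) (auto simp: QP)
  also have "\<dots> = (\<Sum>k<N. B $$ (k, k))" by simp
  also have "\<dots> = sum_list es"
    using carr by (simp add: diag[symmetric] diag_mat_def sum_list_sum_nth atLeast0LessThan)
  finally have tr: "sum_list es = (\<Sum>i<N. g i i)" ..
  have "\<exists>w. (\<exists>i<N. w i \<noteq> 0) \<and> (\<forall>i<N. (\<Sum>j<N. g i j * w j) = e * w i)"
    if e: "e \<in> set es" for e
  proof -
    have "poly (char_poly A) e = 0"
      using e unfolding es(1) poly_prod_list by (force simp: prod_list_zero_iff)
    then obtain v where "eigenvector A v e"
      using eigenvalue_root_char_poly[OF A] unfolding eigenvalue_def by blast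
    hence v: "v \<in> carrier_vec N" "v \<noteq> 0\<^sub>v N" "A *\<^sub>v v = e \<cdot>\<^sub>v v"
      using A by (auto simp: eigenvector_def)
    have "\<exists>i<N. v $ i \<noteq> 0" using v(1,2) by (metis carrier_vecD eq_vecI index_zero_vec)
    moreover have "(\<Sum>j<N. g i j * v $ j) = e * v $ i" if "i < N" for i
      using arg_cong[OF v(3), of "\<lambda>x. x $ i"] that v(1)
      by (simp add: A_def scalar_prod_def atLeast0LessThan)
    ultimately show ?thesis by (intro exI[of _ "\<lambda>i. v $ i"]) auto
  qed
  with that es(2) tr show thesis by blast
qed

text \<open>Deflation: adding \<open>c\<close> times the projection onto the span of the
  \<open>u k\<close> moves their eigenvalues to \<open>eig k + c\<close>. Pairing an eigenvector of
  the deformed matrix with \<open>u k\<close> and using Hermiticity gives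
  \<open>(e - (eig k + c)) * ip k = 0\<close>. An eigenvalue that avoids all shifted values thus has
  its eigenvectors in the orthogonal complement, where the deformed matrix and \<open>h\<close>
  agree.\<close>

lemma hermitian_eigenvector_in_complement:
  fixes h :: "nat \<Rightarrow> nat \<Rightarrow> complex" and u :: "nat \<Rightarrow> nat \<Rightarrow> complex" and eig :: "nat \<Rightarrow> real"
  assumes herm: "\<And>i j. i < N \<Longrightarrow> j < N \<Longrightarrow> h j i = cnj (h i j)"
    and on: "\<And>k l. k < K \<Longrightarrow> l < K \<Longrightarrow> (\<Sum>i<N. cnj (u k i) * u l i) = (if k = l then 1 else 0)"
    and eig: "\<And>k i. k < K \<Longrightarrow> i < N \<Longrightarrow> (\<Sum>j<N. h i j * u k j) = eig k * u k i"
    and K: "K < N"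
  obtains w e where "\<exists>i<N. w i \<noteq> 0" "\<And>i. i < N \<Longrightarrow> (\<Sum>j<N. h i j * w j) = e * w i"
    "\<And>k. k < K \<Longrightarrow> (\<Sum>i<N. cnj (u k i) * w i) = 0"
proof -
  define L where "L = (\<Sum>k<K. \<bar>eig k\<bar>)"
  define c :: real where "c = N * L + cmod (\<Sum>i<N. h i i) + 1"
  \<comment> \<open>The shift by \<open>c\<close> on the span of the known eigenvectors raises the trace by only \<open>K c\<close>, so
    not all \<open>N\<close> eigenvalues of \<open>g\<close> can be shifted ones.\<close>
  define g where "g = (\<lambda>i j. h i j + c * (\<Sum>k<K. u k i * cnj (u k j)))"
  obtain es where es: "length es = N" "sum_list es = (\<Sum>i<N. g i i)"
    "\<And>e. e \<in> set es \<Longrightarrow> \<exists>w. (\<exists>i<N. w i \<noteq> 0) \<and> (\<forall>i<N. (\<Sum>j<N. g i j * w j) = e * w i)"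
    using eigenvalues_with_trace[of N g] by blast
  have L0: "L \<ge> 0" by (simp add: L_def sum_nonneg)
  have evL: "\<bar>eig k\<bar> \<le> L" if "k < K" for k
    unfolding L_def by (rule member_le_sum) (use that in auto)
  have "\<exists>e\<in>set es. \<forall>k<K. e \<noteq> eig k + c"
  proof (rule ccontr)
    \<comment> \<open>Otherwise every eigenvalue lies within \<open>L\<close> of \<open>c\<close>,
      so the sum of the differences has modulus at most \<open>N * L\<close>. That sum is tr h - c
      (N - K), of modulus at least c - |tr h| = N L + 1, which is how \<open>c\<close> was
      chosen.\<close>
    assume "\<not> ?thesis"
    hence "\<exists>k<K. e - c = eig k" if "e \<in> set es" for e using that by force
    hence "cmod (e - c) \<le> L" if "e \<in> set es" for e using that evL by (metis norm_of_real)
    hence "cmod (es ! i - c) \<le> L" if "i < N" for i using that es(1) by auto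
    hence "(\<Sum>i<N. cmod (es ! i - c)) \<le> N * L"
      using sum_bounded_above[of "{..<N}" "\<lambda>i. cmod (es ! i - c)" L] by simp
    hence 1: "cmod (\<Sum>i<N. es ! i - c) \<le> N * L" by (rule order_trans[OF norm_sum])
    have "(\<Sum>i<N. \<Sum>k<K. u k i * cnj (u k i)) = (\<Sum>k<K. \<Sum>i<N. cnj (u k i) * u k i)"
      by (subst sum.swap) (simp add: mult.commute)
    also have "\<dots> = of_nat K" by (simp add: on)
    finally have "(\<Sum>i<N. g i i) = (\<Sum>i<N. h i i) + c * K"
      by (simp add: g_def sum.distrib flip: sum_distrib_left)
    hence "(\<Sum>i<N. es ! i - c) = (\<Sum>i<N. h i i) - c * (real N - real K)"
      using es(1,2) by (simp add: sum_subtractf sum_list_sum_nth atLeast0LessThan algebra_simps)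
    hence "cmod (of_real (c * (real N - real K))) \<le> N * L + cmod (\<Sum>i<N. h i i)"
      using 1 norm_triangle_ineq2[of "of_real (c * (real N - real K))" "\<Sum>i<N. h i i"]
      by (simp add: norm_minus_commute)
    moreover have c0: "c \<ge> 1" using L0 by (simp add: c_def)
    hence "c * 1 \<le> c * (real N - real K)" using K by (intro mult_left_mono) auto
    ultimately show False using c0 K by (simp only: norm_of_real) (simp add: c_def)
  qed
  then obtain e where e: "e \<in> set es" "\<And>k. k < K \<Longrightarrow> e \<noteq> eig k + c" by blast
  then obtain w where w: "\<exists>i<N. w i \<noteq> 0" "\<And>i. i < N \<Longrightarrow> (\<Sum>j<N. g i j * w j) = e * w i"
    using es(3) by blast
  define ip where "ip = (\<lambda>k. \<Sum>i<N. cnj (u k i) * w i)"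
  have gw: "(\<Sum>j<N. g i j * w j) = (\<Sum>j<N. h i j * w j) + c * (\<Sum>k<K. u k i * ip k)" for i
  proof -
    have "(\<Sum>j<N. (\<Sum>k<K. u k i * cnj (u k j)) * w j) = (\<Sum>k<K. u k i * ip k)"
      unfolding ip_def sum_distrib_left sum_distrib_right
      by (subst sum.swap) (simp add: mult_ac)
    thus ?thesis by (simp add: g_def ring_distribs sum.distrib sum_distrib_left mult.assoc flip: sum_distrib_left)
  qed
  have ip0: "ip k = 0" if k: "k < K" for k
  proof -
    have "e * ip k = (\<Sum>i<N. cnj (u k i) * (\<Sum>j<N. g i j * w j))"
      unfolding ip_def sum_distrib_left[of e] by (intro sum.cong refl) (simp add: w(2))
    also have "\<dots> = (\<Sum>i<N. cnj (u k i) * (\<Sum>j<N. h i j * w j))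
        + c * (\<Sum>i<N. cnj (u k i) * (\<Sum>l<K. u l i * ip l))"
      unfolding gw by (simp add: distrib_left sum.distrib sum_distrib_left mult_ac)
    also have "(\<Sum>i<N. cnj (u k i) * (\<Sum>j<N. h i j * w j))
        = (\<Sum>j<N. (\<Sum>i<N. cnj (u k i) * h i j) * w j)"
      unfolding sum_distrib_left sum_distrib_right by (subst sum.swap) (simp add: mult_ac)
    also have "\<dots> = (\<Sum>j<N. cnj (\<Sum>i<N. h j i * u k i) * w j)"
      by (intro sum.cong refl) (simp add: herm[symmetric] mult_ac)
    also have "\<dots> = eig k * ip k"
      unfolding ip_def sum_distrib_left[of "of_real (eig k)"] by (intro sum.cong refl) (simp add: eig k)
    also have "(\<Sum>i<N. cnj (u k i) * (\<Sum>l<K. u l i * ip l)) = (\<Sum>l<K. (\<Sum>i<N. cnj (u k i) * u l i) * ip l)"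
      unfolding sum_distrib_left sum_distrib_right by (subst sum.swap) (simp add: mult_ac)
    also have "\<dots> = (\<Sum>l<K. if l = k then ip k else 0)"
      by (intro sum.cong refl) (simp add: on k)
    also have "\<dots> = ip k" using k by simp
    finally have "(e - (eig k + c)) * ip k = 0" by (simp add: algebra_simps)
    thus ?thesis using e(2)[OF k] by simp
  qed
  show thesis
  proof (rule that[OF w(1)])
    show "(\<Sum>j<N. h i j * w j) = e * w i" if "i < N" for i
      using w(2)[OF that] by (simp add: gw ip0)
  qed (use ip0 in \<open>simp add: ip_def\<close>)
qed

text \<open>Induction on the number of vectors: the next one is taken from the complement of those
  already found and rescaled to norm 1. Its eigenvalue is real because letting \<open>h\<close> act
  to the right or to the left in <w|h w> gives \<open>e * s\<close> and
  \<open>cnj e * s\<close>.\<close>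

lemma hermitian_orthonormal_eigenvectors:
  fixes h :: "nat \<Rightarrow> nat \<Rightarrow> complex"
  assumes herm: "\<And>i j. i < N \<Longrightarrow> j < N \<Longrightarrow> h j i = cnj (h i j)"
    and "K \<le> N"
  shows "\<exists>(u :: nat \<Rightarrow> nat \<Rightarrow> complex) (eig :: nat \<Rightarrow> real).
    (\<forall>k<K. \<forall>l<K. (\<Sum>i<N. cnj (u k i) * u l i) = (if k = l then 1 else 0)) \<and>
    (\<forall>k<K. \<forall>i<N. (\<Sum>j<N. h i j * u k j) = eig k * u k i)"
  using assms(2)
proof (induction K)
  case (Suc K)
  from Suc.prems have "K \<le> N" by simp
  from Suc.IH[OF this] obtain u :: "nat \<Rightarrow> nat \<Rightarrow> complex" and eig :: "nat \<Rightarrow> real" where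
    u: "\<And>k l. k < K \<Longrightarrow> l < K \<Longrightarrow> (\<Sum>i<N. cnj (u k i) * u l i) = (if k = l then 1 else 0)"
    "\<And>k i. k < K \<Longrightarrow> i < N \<Longrightarrow> (\<Sum>j<N. h i j * u k j) = eig k * u k i" by blast
  have "K < N" using Suc.prems by simp
  note * = hermitian_eigenvector_in_complement[where h = h and u = u and eig = eig, OF herm u this]
  obtain w e where w: "\<exists>i<N. w i \<noteq> 0" "\<And>i. i < N \<Longrightarrow> (\<Sum>j<N. h i j * w j) = e * w i"
    "\<And>k. k < K \<Longrightarrow> (\<Sum>i<N. cnj (u k i) * w i) = 0"
    by (rule *) (assumption | rule that)+
  define s where "s = (\<Sum>i<N. (cmod (w i))\<^sup>2)"
  have s0: "s > 0" unfolding s_def using w(1) by (auto intro!: sum_pos2)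
  have s: "(\<Sum>i<N. cnj (w i) * w i) = s"
    unfolding s_def of_real_sum by (intro sum.cong refl) (simp only: complex_norm_square mult.commute)
  have "e * s = (\<Sum>i<N. cnj (w i) * (\<Sum>j<N. h i j * w j))"
    unfolding s[symmetric] sum_distrib_left[of e] by (intro sum.cong refl) (simp add: w(2))
  also have "\<dots> = (\<Sum>j<N. cnj (\<Sum>i<N. h j i * w i) * w j)"
    unfolding sum_distrib_left sum_distrib_right cnj_sum
    by (subst sum.swap) (intro sum.cong refl, simp add: herm[symmetric] mult_ac)
  also have "\<dots> = cnj e * s"
    unfolding s[symmetric] sum_distrib_left[of "cnj e"] by (intro sum.cong refl) (simp add: w(2))
  finally have "e = cnj e" using s0 by simp
  hence e: "complex_of_real (Re e) = e" by (simp add: complex_eq_iff)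
  define v where "v = (\<lambda>i. w i / of_real (sqrt s))"
  have vv: "(\<Sum>i<N. cnj (v i) * v i) = 1"
  proof -
    have "(\<Sum>i<N. cnj (v i) * v i) = (\<Sum>i<N. cnj (w i) * w i) / (of_real (sqrt s) * of_real (sqrt s))"
      by (simp add: v_def sum_divide_distrib)
    also have "\<dots> = 1" using s0 by (simp add: s flip: of_real_mult)
    finally show ?thesis .
  qed
  have uv: "(\<Sum>i<N. cnj (u k i) * v i) = 0" if "k < K" for k
    using w(3)[OF that] by (simp add: v_def flip: sum_divide_distrib)
  have vu: "(\<Sum>i<N. cnj (v i) * u k i) = 0" if "k < K" for k
    using arg_cong[OF uv[OF that], of cnj] by (simp add: mult.commute)
  have hv: "(\<Sum>j<N. h i j * v j) = e * v i" if "i < N" for i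
    using w(2)[OF that] by (simp add: v_def flip: sum_divide_distrib)
  have 1: "(\<Sum>i<N. cnj ((u(K := v)) k i) * (u(K := v)) l i) = (if k = l then 1 else 0)"
    if "k < Suc K" "l < Suc K" for k l
    using that by (cases "k = K"; cases "l = K") (simp_all add: u(1) vv uv vu)
  have 2: "(\<Sum>j<N. h i j * (u(K := v)) k j) = (eig(K := Re e)) k * (u(K := v)) k i"
    if "k < Suc K" "i < N" for k i
    using that by (cases "k = K") (simp_all add: u(2) hv e)
  show ?case
    using 1 2 by blast
qed simp

text \<open>Orthonormality says that the conjugate transpose is a left inverse of the square matrix
  with columns \<open>u k\<close>; a left inverse is also a right inverse, which is
  completeness.\<close>

lemma orthonormal_family_complete:
  fixes u :: "nat \<Rightarrow> nat \<Rightarrow> complex"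
  assumes on: "\<And>k l. k < N \<Longrightarrow> l < N \<Longrightarrow> (\<Sum>i<N. cnj (u k i) * u l i) = (if k = l then 1 else 0)"
    and "i < N" "j < N"
  shows "(\<Sum>k<N. u k i * cnj (u k j)) = (if i = j then 1 else 0)"
proof -
  define U where "U = mat N N (\<lambda>(i, k). u k i)"
  define V where "V = mat N N (\<lambda>(k, i). cnj (u k i))"
  have UV: "U \<in> carrier_mat N N" "V \<in> carrier_mat N N" by (auto simp: U_def V_def)
  have "V * U = 1\<^sub>m N"
    by (rule eq_matI) (auto simp: U_def V_def scalar_prod_def atLeast0LessThan on)
  from mat_mult_left_right_inverse[OF UV(2,1) this] have "(U * V) $$ (i, j) = 1\<^sub>m N $$ (i, j)" by simp
  thus ?thesis using assms(2,3) by (simp add: U_def V_def scalar_prod_def atLeast0LessThan)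
qed

lemma hermitian_spectral_theorem:
  fixes h :: "nat \<Rightarrow> nat \<Rightarrow> complex"
  assumes herm: "\<And>i j. i < N \<Longrightarrow> j < N \<Longrightarrow> h j i = cnj (h i j)"
  obtains u eig where "spectral_decomposition N h u eig"
proof -
  have "\<exists>(u :: nat \<Rightarrow> nat \<Rightarrow> complex) (eig :: nat \<Rightarrow> real).
    (\<forall>k<N. \<forall>l<N. (\<Sum>i<N. cnj (u k i) * u l i) = (if k = l then 1 else 0)) \<and>
    (\<forall>k<N. \<forall>i<N. (\<Sum>j<N. h i j * u k j) = eig k * u k i)"
    by (rule hermitian_orthonormal_eigenvectors) (erule (1) herm, rule order_refl)
  then obtain u :: "nat \<Rightarrow> nat \<Rightarrow> complex" and eig :: "nat \<Rightarrow> real" where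
    on: "\<forall>k<N. \<forall>l<N. (\<Sum>i<N. cnj (u k i) * u l i) = (if k = l then 1 else 0)"
    and eig: "\<forall>k<N. \<forall>i<N. (\<Sum>j<N. h i j * u k j) = eig k * u k i"
    by blast
  have cm: "(\<Sum>k<N. u k i * cnj (u k j)) = (if i = j then 1 else 0)" if "i < N" "j < N" for i j
    by (rule orthonormal_family_complete) (use on that in auto)
  have "h i j = (\<Sum>k<N. eig k * (u k i * cnj (u k j)))" if ij: "i < N" "j < N" for i j
  proof -
    have "(\<Sum>k<N. eig k * (u k i * cnj (u k j))) = (\<Sum>k<N. (\<Sum>l<N. h i l * u k l) * cnj (u k j))"
      by (intro sum.cong refl) (simp add: eig ij)
    also have "\<dots> = (\<Sum>l<N. h i l * (\<Sum>k<N. u k l * cnj (u k j)))"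
      unfolding sum_distrib_left sum_distrib_right by (subst sum.swap) (simp add: mult_ac)
    also have "\<dots> = (\<Sum>l<N. if l = j then h i j else 0)"
      by (intro sum.cong refl) (simp add: cm ij)
    also have "\<dots> = h i j" using ij by simp
    finally show ?thesis ..
  qed
  with on cm have "spectral_decomposition N h u eig"
    by (simp add: spectral_decomposition_def orthonormal_basis_def)
  thus thesis by (rule that)
qed

section \<open>Time averages in an eigenbasis\<close>

lemma
  assumes "spectral_decomposition N h u eig"
  shows spectral_decompositionD1: "\<And>k l. k < N \<Longrightarrow> l < N \<Longrightarrow> (\<Sum>i<N. cnj (u k i) * u l i) = (if k = l then 1 else 0)"
    and spectral_decompositionD2: "\<And>i j. i < N \<Longrightarrow> j < N \<Longrightarrow> (\<Sum>k<N. u k i * cnj (u k j)) = (if i = j then 1 else 0)"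
    and spectral_decompositionD3: "\<And>i j. i < N \<Longrightarrow> j < N \<Longrightarrow> h i j = (\<Sum>k<N. eig k * (u k i * cnj (u k j)))"
  using assms by (simp_all add: spectral_decomposition_def orthonormal_basis_def)

text \<open>\<open>mat_exp\<close> is an entrywise power series, so the powers are diagonalised
  before the exponential is.\<close>

lemma smult_pow_mat_spectral:
  fixes c :: complex
  assumes H: "H \<in> carrier_mat N N"
    and sd: "spectral_decomposition N (\<lambda>i j. H $$ (i, j)) u eig"
  shows "i < N \<Longrightarrow> j < N \<Longrightarrow>
    ((c \<cdot>\<^sub>m H) ^\<^sub>m p) $$ (i, j) = (\<Sum>k<N. (c * eig k) ^ p * (u k i * cnj (u k j)))"
proof (induction p arbitrary: j)
  case 0
  from 0 show ?case using H spectral_decompositionD2[OF sd] by simp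
next
  case (Suc p)
  note on = spectral_decompositionD1[OF sd] and dec = spectral_decompositionD3[OF sd]
  have cH: "c \<cdot>\<^sub>m H \<in> carrier_mat N N" using H by simp
  have "((c \<cdot>\<^sub>m H) ^\<^sub>m Suc p) $$ (i, j) = (\<Sum>m<N. ((c \<cdot>\<^sub>m H) ^\<^sub>m p) $$ (i, m) * (c * H $$ (m, j)))"
    using Suc.prems H pow_carrier_mat[OF cH, of p] by (simp add: scalar_prod_def atLeast0LessThan)
  also have "\<dots> = (\<Sum>m<N. (\<Sum>k<N. (c * eig k) ^ p * (u k i * cnj (u k m))) *
      (\<Sum>l<N. c * (eig l * (u l m * cnj (u l j)))))"
    by (intro sum.cong refl) (simp add: Suc dec sum_distrib_left)
  also have "\<dots> = (\<Sum>m<N. \<Sum>k<N. \<Sum>l<N. (c * eig k) ^ p * u k i * (c * eig l) * cnj (u l j) * (cnj (u k m) * u l m))"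
    unfolding sum_product by (simp add: mult_ac)
  also have "\<dots> = (\<Sum>k<N. \<Sum>m<N. \<Sum>l<N. (c * eig k) ^ p * u k i * (c * eig l) * cnj (u l j) * (cnj (u k m) * u l m))"
    by (rule sum.swap)
  also have "\<dots> = (\<Sum>k<N. \<Sum>l<N. \<Sum>m<N. (c * eig k) ^ p * u k i * (c * eig l) * cnj (u l j) * (cnj (u k m) * u l m))"
    by (rule sum.cong[OF refl], rule sum.swap)
  also have "\<dots> = (\<Sum>k<N. \<Sum>l<N. if k = l then (c * eig k) ^ p * u k i * (c * eig k) * cnj (u k j) else 0)"
    by (intro sum.cong refl) (simp add: on flip: sum_distrib_left)
  also have "\<dots> = (\<Sum>k<N. (c * eig k) ^ Suc p * (u k i * cnj (u k j)))"
    by (intro sum.cong refl) (simp add: mult_ac)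
  finally show ?case .
qed

lemma mat_exp_spectral:
  fixes c :: complex
  assumes H: "H \<in> carrier_mat N N"
    and sd: "spectral_decomposition N (\<lambda>i j. H $$ (i, j)) u eig"
  shows "\<forall>i<N. \<forall>j<N. mat_exp (c \<cdot>\<^sub>m H) $$ (i, j) = (\<Sum>k<N. exp (c * eig k) * (u k i * cnj (u k j)))"
proof (intro allI impI)
  fix i j assume ij: "i < N" "j < N"
  have "(\<lambda>p. \<Sum>k<N. (c * eig k) ^ p /\<^sub>R fact p * (u k i * cnj (u k j)))
      sums (\<Sum>k<N. exp (c * eig k) * (u k i * cnj (u k j)))"
    by (intro sums_sum sums_mult2 exp_converges)
  moreover have "(\<Sum>k<N. (c * eig k) ^ p /\<^sub>R fact p * (u k i * cnj (u k j))) =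
      ((c \<cdot>\<^sub>m H) ^\<^sub>m p) $$ (i, j) / of_nat (fact p)" for p
    by (simp add: smult_pow_mat_spectral[OF H sd ij]
        sum_divide_distrib scaleR_conv_of_real field_simps)
  ultimately show "mat_exp (c \<cdot>\<^sub>m H) $$ (i, j) = (\<Sum>k<N. exp (c * eig k) * (u k i * cnj (u k j)))"
    using H ij by (simp add: mat_exp_def sums_iff)
qed

text \<open>\<open>E\<close> and \<open>F\<close> stand for the propagators exp(iHt) and exp(-iHt).
  In the eigenbasis the whole time dependence sits in the scalars \<open>e k * f l\<close>, and the
  remaining factor can be pulled out of the time integral.\<close>

lemma expval_mult_spectral:
  fixes u :: "nat \<Rightarrow> nat \<Rightarrow> complex"
  assumes A: "A \<in> carrier_mat N N" and E: "E \<in> carrier_mat N N" and F: "F \<in> carrier_mat N N"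
    and Ev: "\<forall>i<N. \<forall>j<N. E $$ (i, j) = (\<Sum>k<N. e k * (u k i * cnj (u k j)))"
    and Fv: "\<forall>i<N. \<forall>j<N. F $$ (i, j) = (\<Sum>k<N. f k * (u k i * cnj (u k j)))"
    and v: "dim_vec v = N"
  defines "p \<equiv> \<lambda>k. \<Sum>i<N. cnj (u k i) * v $ i"
  shows "expval v (E * A * F) = (\<Sum>k<N. \<Sum>l<N. e k * f l *
    (cnj (p k) * p l * (\<Sum>x<N. \<Sum>y<N. cnj (u k x) * A $$ (x, y) * u l y)))"
proof -
  define L where "L = (\<lambda>x. \<Sum>i<N. cnj (v $ i) * E $$ (i, x))"
  define R where "R = (\<lambda>y. \<Sum>j<N. F $$ (y, j) * v $ j)"
  have L: "L x = (\<Sum>k<N. e k * (cnj (p k) * cnj (u k x)))" if "x < N" for x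
  proof -
    have "L x = (\<Sum>i<N. \<Sum>k<N. cnj (v $ i) * (e k * (u k i * cnj (u k x))))"
      unfolding L_def by (intro sum.cong refl) (simp add: Ev that sum_distrib_left)
    thus ?thesis
      by (subst (asm) sum.swap) (simp add: p_def sum_distrib_left sum_distrib_right mult_ac)
  qed
  have R: "R y = (\<Sum>l<N. f l * (p l * u l y))" if "y < N" for y
  proof -
    have "R y = (\<Sum>j<N. \<Sum>k<N. f k * (u k y * cnj (u k j)) * v $ j)"
      unfolding R_def by (intro sum.cong refl) (simp add: Fv that sum_distrib_right)
    thus ?thesis
      by (subst (asm) sum.swap) (simp add: p_def sum_distrib_left sum_distrib_right mult_ac)
  qed
  have prod: "(E * A * F) $$ (i, j) = (\<Sum>y<N. (\<Sum>x<N. E $$ (i, x) * A $$ (x, y)) * F $$ (y, j))"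
    if "i < N" "j < N" for i j
    using A E F that by (auto simp: scalar_prod_def atLeast0LessThan simp del: assoc_mult_mat intro!: sum.cong)
  have "expval v (E * A * F) = (\<Sum>i<N. \<Sum>j<N. \<Sum>y<N. \<Sum>x<N.
      cnj (v $ i) * E $$ (i, x) * A $$ (x, y) * (F $$ (y, j) * v $ j))"
    unfolding expval_def v by (intro sum.cong refl)
      (simp add: prod sum_distrib_left sum_distrib_right mult_ac)
  also have "\<dots> = (\<Sum>i<N. \<Sum>y<N. \<Sum>x<N. \<Sum>j<N.
      cnj (v $ i) * E $$ (i, x) * A $$ (x, y) * (F $$ (y, j) * v $ j))"
    by (rule sum.cong[OF refl], subst sum.swap, rule sum.cong[OF refl], rule sum.swap)
  also have "\<dots> = (\<Sum>i<N. \<Sum>y<N. \<Sum>x<N. cnj (v $ i) * E $$ (i, x) * A $$ (x, y) * R y)"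
    by (simp add: R_def sum_distrib_left)
  also have "\<dots> = (\<Sum>y<N. \<Sum>x<N. \<Sum>i<N. cnj (v $ i) * E $$ (i, x) * A $$ (x, y) * R y)"
    by (subst sum.swap, rule sum.cong[OF refl], rule sum.swap)
  also have "\<dots> = (\<Sum>y<N. \<Sum>x<N. L x * A $$ (x, y) * R y)"
    by (simp add: L_def sum_distrib_right)
  also have "\<dots> = (\<Sum>x<N. \<Sum>y<N. L x * A $$ (x, y) * R y)" by (rule sum.swap)
  also have "\<dots> = (\<Sum>x<N. \<Sum>y<N. \<Sum>k<N. \<Sum>l<N.
      e k * f l * (cnj (p k) * p l * (cnj (u k x) * A $$ (x, y) * u l y)))"
    by (intro sum.cong refl) (simp add: L R sum_distrib_left sum_distrib_right mult_ac)
  also have "\<dots> = (\<Sum>x<N. \<Sum>k<N. \<Sum>l<N. \<Sum>y<N.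
      e k * f l * (cnj (p k) * p l * (cnj (u k x) * A $$ (x, y) * u l y)))"
    by (rule sum.cong[OF refl], subst sum.swap, rule sum.cong[OF refl], rule sum.swap)
  also have "\<dots> = (\<Sum>k<N. \<Sum>l<N. \<Sum>x<N. \<Sum>y<N.
      e k * f l * (cnj (p k) * p l * (cnj (u k x) * A $$ (x, y) * u l y)))"
    by (subst sum.swap, rule sum.cong[OF refl], rule sum.swap)
  finally show ?thesis by (simp add: sum_distrib_left)
qed

lemma integral_exp_imaginary:
  fixes \<mu> :: real
  assumes "\<mu> \<noteq> 0" "\<tau> \<ge> 0"
  shows "((\<lambda>t. exp (\<i> * of_real (t * \<mu>))) has_integral
    (exp (\<i> * of_real (\<tau> * \<mu>)) - 1) / (\<i> * of_real \<mu>)) {0..\<tau>}"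
proof -
  have "((\<lambda>t. exp (\<i> * of_real (t * \<mu>)) / (\<i> * of_real \<mu>)) has_vector_derivative
      exp (\<i> * of_real (t * \<mu>))) (at t within {0..\<tau>})" for t
  proof -
    have "((\<lambda>z. exp (\<i> * (z * of_real \<mu>)) / (\<i> * of_real \<mu>)) has_field_derivative
        exp (\<i> * (of_real t * of_real \<mu>))) (at (of_real t))"
      using assms(1) by (auto intro!: derivative_eq_intros simp: mult.commute mult.left_commute)
    from has_vector_derivative_real_field[OF this] show ?thesis by simp
  qed
  from fundamental_theorem_of_calculus[OF assms(2) this] show ?thesis
    by (simp add: diff_divide_distrib)
qed

text \<open>For nonzero frequency the integral stays bounded by 2 / |\<mu>| for all times, so its
  average decays like 1 / \<tau>; only frequency zero survives.\<close>

lemma average_exp_imaginary: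
  fixes \<mu> :: real
  shows "((\<lambda>\<tau>::real. complex_of_real (1 / \<tau>) * integral {0..\<tau>} (\<lambda>t. exp (\<i> * of_real (t * \<mu>))))
    \<longlongrightarrow> (if \<mu> = 0 then 1 else 0)) at_top"
proof (cases "\<mu> = 0")
  case True
  have "eventually (\<lambda>\<tau>::real. complex_of_real (1 / \<tau>) * integral {0..\<tau>} (\<lambda>t. exp (\<i> * of_real (t * \<mu>))) = 1) at_top"
    using eventually_gt_at_top[of 0] by eventually_elim (simp add: True scaleR_conv_of_real)
  thus ?thesis by (simp add: True tendsto_eventually)
next
  case False
  have "eventually (\<lambda>\<tau>::real. cmod (complex_of_real (1 / \<tau>) * integral {0..\<tau>} (\<lambda>t. exp (\<i> * of_real (t * \<mu>))))
      \<le> 2 / \<bar>\<mu>\<bar> * inverse \<tau>) at_top"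
    using eventually_gt_at_top[of 0]
  proof eventually_elim
    case (elim \<tau>)
    have eq: "integral {0..\<tau>} (\<lambda>t. exp (\<i> * of_real (t * \<mu>))) = (exp (\<i> * of_real (\<tau> * \<mu>)) - 1) / (\<i> * of_real \<mu>)"
      by (rule integral_unique[OF integral_exp_imaginary[OF False]]) (use elim in simp)
    have "cmod (exp (\<i> * of_real (\<tau> * \<mu>)) - 1) \<le> 2"
      using norm_triangle_ineq4[of "exp (\<i> * of_real (\<tau> * \<mu>))" 1] by (simp del: of_real_mult)
    thus ?case
      unfolding eq using elim False by (simp add: norm_mult norm_divide divide_simps del: of_real_mult)
  qed
  moreover have "((\<lambda>\<tau>::real. 2 / \<bar>\<mu>\<bar> * inverse \<tau>) \<longlongrightarrow> 0) at_top"
    by (intro tendsto_mult_right_zero tendsto_inverse_0_at_top filterlim_ident)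
  ultimately show ?thesis using False by (auto intro: Lim_null_comparison)
qed

lemma time_avg_spectral:
  assumes H: "H \<in> carrier_mat N N" and A: "A \<in> carrier_mat N N"
    and sd: "spectral_decomposition N (\<lambda>i j. H $$ (i, j)) u eig"
    and inj: "inj_on eig {..<N}" and v: "dim_vec v = N"
  shows "time_avg H A v = (\<Sum>k<N. of_real ((cmod (\<Sum>i<N. cnj (u k i) * v $ i))\<^sup>2) *
    (\<Sum>x<N. \<Sum>y<N. cnj (u k x) * A $$ (x, y) * u k y))"
proof -
  define p where "p = (\<lambda>k. \<Sum>i<N. cnj (u k i) * v $ i)"
  define a where "a = (\<lambda>k l. cnj (p k) * p l * (\<Sum>x<N. \<Sum>y<N. cnj (u k x) * A $$ (x, y) * u l y))"
  have ex: "expval v (mat_exp (complex_of_real t * \<i> \<cdot>\<^sub>m H) * A * mat_exp (- (complex_of_real t * \<i>) \<cdot>\<^sub>m H))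
      = (\<Sum>k<N. \<Sum>l<N. exp (\<i> * of_real (t * (eig k - eig l))) * a k l)" for t
  proof -
    have car: "mat_exp (c \<cdot>\<^sub>m H) \<in> carrier_mat N N" for c
      using H by (simp add: mat_exp_def)
    have "exp (complex_of_real t * \<i> * eig k) * exp (- (complex_of_real t * \<i>) * eig l)
        = exp (\<i> * of_real (t * (eig k - eig l)))" for k l
      by (simp add: algebra_simps flip: exp_add)
    with expval_mult_spectral[OF A car car mat_exp_spectral[OF H sd]
        mat_exp_spectral[OF H sd] v,
        of "complex_of_real t * \<i>" "- (complex_of_real t * \<i>)"]
    show ?thesis by (simp add: a_def p_def)
  qed
  have int: "(\<lambda>t. exp (\<i> * of_real (t * \<mu>)) * z) integrable_on {0..\<tau>}" for \<mu> \<tau> :: real and z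
    by (intro integrable_continuous_real continuous_intros)
  have "integral {0..\<tau>} (\<lambda>t. \<Sum>k<N. \<Sum>l<N. exp (\<i> * of_real (t * (eig k - eig l))) * a k l)
      = (\<Sum>k<N. \<Sum>l<N. integral {0..\<tau>} (\<lambda>t. exp (\<i> * of_real (t * (eig k - eig l)))) * a k l)" for \<tau>
    by (simp add: integral_sum integrable_sum int del: of_real_mult of_real_diff)
  hence "complex_of_real (1 / \<tau>) * integral {0..\<tau>} (\<lambda>t. \<Sum>k<N. \<Sum>l<N. exp (\<i> * of_real (t * (eig k - eig l))) * a k l)
      = (\<Sum>k<N. \<Sum>l<N. complex_of_real (1 / \<tau>) * integral {0..\<tau>} (\<lambda>t. exp (\<i> * of_real (t * (eig k - eig l)))) * a k l)" for \<tau>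
    by (simp add: sum_distrib_left mult.assoc del: of_real_mult of_real_diff)
  moreover have "((\<lambda>\<tau>. \<Sum>k<N. \<Sum>l<N. complex_of_real (1 / \<tau>) *
        integral {0..\<tau>} (\<lambda>t. exp (\<i> * of_real (t * (eig k - eig l)))) * a k l)
      \<longlongrightarrow> (\<Sum>k<N. \<Sum>l<N. (if eig k - eig l = 0 then 1 else 0) * a k l)) at_top"
    by (intro tendsto_sum tendsto_mult average_exp_imaginary tendsto_const)
  ultimately have "time_avg H A v = (\<Sum>k<N. \<Sum>l<N. (if eig k - eig l = 0 then 1 else 0) * a k l)"
    unfolding time_avg_def ex by (intro tendsto_Lim) simp_all
  \<comment> \<open>Injectivity of \<open>eig\<close> turns equality of two energies into equality
    of their indices: no coherence between different eigenvectors is left.\<close>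
  also have "\<dots> = (\<Sum>k<N. \<Sum>l<N. if l = k then a k k else 0)"
    using inj by (intro sum.cong refl) (auto simp: inj_on_def)
  also have "\<dots> = (\<Sum>k<N. a k k)" by simp
  also have "\<dots> = (\<Sum>k<N. of_real ((cmod (p k))\<^sup>2) * (\<Sum>x<N. \<Sum>y<N. cnj (u k x) * A $$ (x, y) * u k y))"
    unfolding a_def by (simp only: complex_norm_square mult.commute[of "cnj (p _)"])
  finally show ?thesis by (simp only: p_def)
qed

text \<open>\<open>H\<close> is similar to the diagonal matrix of the \<open>eig k\<close>, so its
  characteristic polynomial is the product of the corresponding linear factors. Two equal values
  would put the square of one factor into it and raise the order of that root to 2.\<close>

lemma nondegenerate_spectrum_inj:
  assumes H: "H \<in> carrier_mat N N" and nd: "nondegenerate_spectrum H"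
    and sd: "spectral_decomposition N (\<lambda>i j. H $$ (i, j)) u eig"
  shows "inj_on eig {..<N}"
proof -
  note on = spectral_decompositionD1[OF sd] and cm = spectral_decompositionD2[OF sd]
    and dec = spectral_decompositionD3[OF sd]
  define U where "U = mat N N (\<lambda>(i, k). u k i)"
  define V where "V = mat N N (\<lambda>(k, i). cnj (u k i))"
  define D where "D = mat N N (\<lambda>(k, l). if k = l then complex_of_real (eig k) else 0)"
  have car: "U \<in> carrier_mat N N" "V \<in> carrier_mat N N" "D \<in> carrier_mat N N"
    by (auto simp: U_def V_def D_def)
  have VU: "V * U = 1\<^sub>m N" and UV: "U * V = 1\<^sub>m N"
    by (rule eq_matI; simp add: U_def V_def scalar_prod_def atLeast0LessThan on cm)+
  have UD: "(U * D) $$ (i, k) = eig k * u k i" if "i < N" "k < N" for i k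
  proof -
    have "(U * D) $$ (i, k) = (\<Sum>l<N. u l i * (if l = k then complex_of_real (eig l) else 0))"
      using that by (simp add: U_def D_def scalar_prod_def atLeast0LessThan)
    also have "\<dots> = (\<Sum>l<N. if l = k then eig k * u k i else 0)"
      by (intro sum.cong refl) auto
    finally show ?thesis using that by simp
  qed
  have "H = U * D * V"
  proof (rule eq_matI)
    fix i j assume "i < dim_row (U * D * V)" "j < dim_col (U * D * V)"
    hence ij: "i < N" "j < N" using car by auto
    have "(U * D * V) $$ (i, j) = (\<Sum>k<N. (U * D) $$ (i, k) * V $$ (k, j))"
      using car ij by (auto simp: scalar_prod_def atLeast0LessThan simp del: assoc_mult_mat intro!: sum.cong)
    also have "\<dots> = H $$ (i, j)"
      unfolding dec[OF ij] by (intro sum.cong refl) (simp add: UD ij, simp add: V_def ij)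
    finally show "H $$ (i, j) = (U * D * V) $$ (i, j)" ..
  qed (use H car in auto)
  hence "similar_mat_wit H D U V"
    using H car VU UV by (intro similar_mat_witI[of _ _ N]) auto
  hence "char_poly H = char_poly D"
    by (intro char_poly_similar) (auto simp: similar_mat_def)
  also have "\<dots> = (\<Prod>a\<leftarrow>diag_mat D. [:- a, 1:])"
    by (rule char_poly_upper_triangular[OF car(3)]) (auto simp: D_def upper_triangular_def)
  also have "diag_mat D = map (\<lambda>k. complex_of_real (eig k)) [0..<N]"
    by (auto simp: diag_mat_def D_def)
  also have "(\<Prod>a\<leftarrow>map (\<lambda>k. complex_of_real (eig k)) [0..<N]. [:- a, 1:]) = (\<Prod>k<N. [:- complex_of_real (eig k), 1:])"
    using prod.distinct_set_conv_list[of "[0..<N]" "\<lambda>k. [:- complex_of_real (eig k), 1:]"]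
    by (simp add: atLeast0LessThan o_def)
  finally have cp: "char_poly H = (\<Prod>k<N. [:- complex_of_real (eig k), 1:])" .
  show ?thesis
  proof (rule inj_onI, rule ccontr)
    fix k l assume kl: "k \<in> {..<N}" "l \<in> {..<N}" "eig k = eig l" "k \<noteq> l"
    have "(\<Prod>m\<in>{k, l}. [:- complex_of_real (eig m), 1:]) dvd char_poly H"
      unfolding cp by (rule prod_dvd_prod_subset) (use kl in auto)
    moreover have "(\<Prod>m\<in>{k, l}. [:- complex_of_real (eig m), 1:]) = [:- complex_of_real (eig k), 1:] ^ 2"
      using kl by (simp add: power2_eq_square del: mult_pCons_left mult_pCons_right)
    ultimately have "[:- complex_of_real (eig k), 1:] ^ 2 dvd char_poly H" by (simp only:)
    moreover have "char_poly H \<noteq> 0" unfolding cp by simp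
    ultimately have "2 \<le> Polynomial.order (complex_of_real (eig k)) (char_poly H)"
      by (simp add: order_divides)
    moreover have "Polynomial.order (complex_of_real (eig k)) (char_poly H) \<le> 1"
      using nd unfolding nondegenerate_spectrum_def by blast
    ultimately show False by simp
  qed
qed

section \<open>Exponential moments in a product basis\<close>

lemma orthonormal_basisD1:
  "orthonormal_basis N u \<Longrightarrow> k < N \<Longrightarrow> l < N \<Longrightarrow> (\<Sum>i<N. cnj (u k i) * u l i) = (if k = l then 1 else 0)"
  by (simp add: orthonormal_basis_def)

lemma orthonormal_basisD2:
  "orthonormal_basis N u \<Longrightarrow> i < N \<Longrightarrow> j < N \<Longrightarrow> (\<Sum>k<N. u k i * cnj (u k j)) = (if i = j then 1 else 0)"
  by (simp add: orthonormal_basis_def)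

lemma spectral_decomposition_basis: "spectral_decomposition N h u eig \<Longrightarrow> orthonormal_basis N u"
  by (simp add: spectral_decomposition_def)

lemma spectral_decomposition_eigenvector:
  assumes "spectral_decomposition N h u eig" "k < N" "i < N"
  shows "(\<Sum>j<N. h i j * u k j) = eig k * u k i"
proof -
  have "(\<Sum>j<N. h i j * u k j) = (\<Sum>j<N. (\<Sum>l<N. eig l * (u l i * cnj (u l j))) * u k j)"
    by (intro sum.cong refl) (simp add: spectral_decompositionD3[OF assms(1)] assms(3))
  also have "\<dots> = (\<Sum>l<N. eig l * u l i * (\<Sum>j<N. cnj (u l j) * u k j))"
    unfolding sum_distrib_left sum_distrib_right by (subst sum.swap) (simp add: mult_ac)
  also have "\<dots> = (\<Sum>l<N. if l = k then eig k * u k i else 0)"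
    by (intro sum.cong refl) (simp add: spectral_decompositionD1[OF assms(1)] assms(2))
  finally show ?thesis using assms(2) by simp
qed

lemma spectral_decomposition_left_eigenvector:
  assumes "spectral_decomposition N h u eig" "k < N" "j < N"
  shows "(\<Sum>i<N. cnj (u k i) * h i j) = eig k * cnj (u k j)"
proof -
  have "(\<Sum>i<N. cnj (u k i) * h i j) = (\<Sum>i<N. cnj (u k i) * (\<Sum>l<N. eig l * (u l i * cnj (u l j))))"
    by (intro sum.cong refl) (simp add: spectral_decompositionD3[OF assms(1)] assms(3))
  also have "\<dots> = (\<Sum>l<N. eig l * cnj (u l j) * (\<Sum>i<N. cnj (u k i) * u l i))"
    unfolding sum_distrib_left sum_distrib_right by (subst sum.swap) (simp add: mult_ac)
  also have "\<dots> = (\<Sum>l<N. if l = k then eig k * cnj (u k j) else 0)"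
    by (intro sum.cong refl) (simp add: spectral_decompositionD1[OF assms(1)] assms(2))
  finally show ?thesis using assms(2) by simp
qed

lemma orthonormal_basis_expand:
  assumes "orthonormal_basis N u" "i < N"
  shows "w i = (\<Sum>l<N. u l i * (\<Sum>j<N. cnj (u l j) * w j))"
proof -
  have "(\<Sum>l<N. u l i * (\<Sum>j<N. cnj (u l j) * w j)) = (\<Sum>j<N. (\<Sum>l<N. u l i * cnj (u l j)) * w j)"
    unfolding sum_distrib_left sum_distrib_right by (subst sum.swap) (simp add: mult_ac)
  also have "\<dots> = (\<Sum>j<N. if j = i then w i else 0)"
    by (intro sum.cong refl) (auto simp: orthonormal_basisD2[OF assms(1)] assms(2))
  finally show ?thesis using assms(2) by simp
qed

lemma sum_cmod_square_basis:
  assumes "orthonormal_basis N u" "k < N"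
  shows "(\<Sum>i<N. (cmod (u k i))\<^sup>2) = 1"
proof -
  have "complex_of_real (\<Sum>i<N. (cmod (u k i))\<^sup>2) = (\<Sum>i<N. cnj (u k i) * u k i)"
    unfolding of_real_sum by (intro sum.cong refl) (simp only: complex_norm_square mult.commute)
  also have "\<dots> = 1" using orthonormal_basisD1[OF assms(1) assms(2) assms(2)] by simp
  finally show ?thesis by (simp only: of_real_eq_1_iff)
qed

text \<open>The permuted eigenvector has the same eigenvalue, so by simplicity of the spectrum it is a
  multiple of the original one.\<close>

lemma eigenvector_of_commuting_permutation:
  assumes sd: "spectral_decomposition N h u eig" and inj: "inj_on eig {..<N}"
    and \<tau>: "bij_betw \<tau> {..<N} {..<N}"
    and inv: "\<forall>i<N. \<forall>j<N. h (\<tau> i) (\<tau> j) = h i j"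
    and k: "k < N"
  shows "\<exists>\<mu>. cmod \<mu> = 1 \<and> (\<forall>i<N. u k (\<tau> i) = \<mu> * u k i)"
proof -
  note ob = spectral_decomposition_basis[OF sd]
  have \<tau>N: "\<tau> i < N" if "i < N" for i using \<tau> that by (auto simp: bij_betw_def)
  define c where "c = (\<lambda>l. \<Sum>j<N. cnj (u l j) * u k (\<tau> j))"
  have h\<tau>: "(\<Sum>j<N. h i j * u k (\<tau> j)) = eig k * u k (\<tau> i)" if i: "i < N" for i
  proof -
    have "(\<Sum>j<N. h i j * u k (\<tau> j)) = (\<Sum>j<N. h (\<tau> i) (\<tau> j) * u k (\<tau> j))"
      by (intro sum.cong refl) (simp add: inv i)
    also have "\<dots> = (\<Sum>j<N. h (\<tau> i) j * u k j)"
      by (rule sum.reindex_bij_betw[OF \<tau>])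
    finally show ?thesis using spectral_decomposition_eigenvector[OF sd k \<tau>N[OF i]] by simp
  qed
  \<comment> \<open>\<open>c l\<close> is the coefficient along \<open>u l\<close> of the permuted
    vector. Evaluating <u_l|h|permuted u_k> to the right and to the left gives
    \<open>eig k * c l = eig l * c l\<close>.\<close>
  have c0: "c l = 0" if l: "l < N" "l \<noteq> k" for l
  proof -
    have "eig k * c l = (\<Sum>i<N. cnj (u l i) * (\<Sum>j<N. h i j * u k (\<tau> j)))"
      unfolding c_def sum_distrib_left[of "of_real (eig k)"] by (intro sum.cong refl) (simp add: h\<tau>)
    also have "\<dots> = (\<Sum>j<N. (\<Sum>i<N. cnj (u l i) * h i j) * u k (\<tau> j))"
      unfolding sum_distrib_left sum_distrib_right by (subst sum.swap) (simp add: mult_ac)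
    also have "\<dots> = eig l * c l"
      unfolding c_def sum_distrib_left[of "of_real (eig l)"]
      by (intro sum.cong refl) (simp add: spectral_decomposition_left_eigenvector[OF sd l(1)])
    finally have "(eig k - eig l) * c l = 0" by (simp add: algebra_simps)
    moreover have "eig k \<noteq> eig l" using inj l k by (auto simp: inj_on_def)
    ultimately show ?thesis by (simp flip: of_real_diff)
  qed
  have eq: "u k (\<tau> i) = c k * u k i" if i: "i < N" for i
  proof -
    have "u k (\<tau> i) = (\<Sum>l<N. u l i * c l)"
      unfolding c_def by (rule orthonormal_basis_expand[OF ob i])
    also have "\<dots> = (\<Sum>l<N. if l = k then u k i * c k else 0)"
      by (intro sum.cong refl) (simp add: c0)
    finally show ?thesis using k by simp
  qed
  have "1 = (\<Sum>i<N. (cmod (u k (\<tau> i)))\<^sup>2)"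
    using sum.reindex_bij_betw[OF \<tau>, of "\<lambda>i. (cmod (u k i))\<^sup>2"] sum_cmod_square_basis[OF ob k] by simp
  also have "\<dots> = (cmod (c k))\<^sup>2 * (\<Sum>i<N. (cmod (u k i))\<^sup>2)"
    unfolding sum_distrib_left by (intro sum.cong refl) (simp add: eq norm_mult power_mult_distrib)
  finally have "(cmod (c k))\<^sup>2 = 1" by (simp add: sum_cmod_square_basis[OF ob k])
  hence "cmod (c k) = 1" by (simp add: power2_eq_1_iff) (use norm_ge_zero[of "c k"] in linarith)
  thus ?thesis using eq by blast
qed

text \<open>Jensen's inequality for a subprobability: the missing mass is placed at the value 0,
  where the exponential is 1. The proof bounds exp below by its tangent at the mean.\<close>

lemma exp_jensen:
  fixes p a :: "'a \<Rightarrow> real"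
  assumes "finite K" "\<And>k. k \<in> K \<Longrightarrow> p k \<ge> 0" "sum p K \<le> 1"
  shows "exp (\<Sum>k\<in>K. p k * a k) \<le> (\<Sum>k\<in>K. p k * exp (a k)) + (1 - sum p K)"
proof -
  define m where "m = (\<Sum>k\<in>K. p k * a k)"
  have tangent: "exp m * (1 + (x - m)) \<le> exp x" for x
    using mult_left_mono[OF exp_ge_add_one_self[of "x - m"], of "exp m"] by (simp flip: exp_add)
  have lin: "(\<Sum>k\<in>K. p k * (e * (1 + (a k - c)))) = e * ((1 - c) * sum p K + (\<Sum>k\<in>K. p k * a k))" for e c
    by (simp add: sum_distrib_left algebra_simps flip: sum.distrib sum_subtractf)
  have "exp m = (\<Sum>k\<in>K. p k * (exp m * (1 + (a k - m)))) + (1 - sum p K) * (exp m * (1 + (0 - m)))"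
    unfolding lin m_def[symmetric] by (simp add: algebra_simps)
  also have "\<dots> \<le> (\<Sum>k\<in>K. p k * exp (a k)) + (1 - sum p K) * exp 0"
    using assms by (intro add_mono sum_mono mult_left_mono tangent) auto
  finally show ?thesis by (simp add: m_def)
qed

text \<open>Both sides are the expectation in \<open>u\<close> of the operator sum of c_\<alpha>
  |W_\<alpha>><W_\<alpha>|. With all weights 1 it yields Parseval identities, with eigenvalues as
  weights it yields expectations of observables.\<close>

lemma weighted_overlap:
  fixes u :: "nat \<Rightarrow> complex" and W :: "nat \<Rightarrow> nat \<Rightarrow> complex" and c :: "nat \<Rightarrow> real"
  shows "of_real (\<Sum>\<alpha><N. (cmod (\<Sum>i<N. cnj (W \<alpha> i) * u i))\<^sup>2 * c \<alpha>)
    = (\<Sum>i<N. \<Sum>j<N. cnj (u i) * (\<Sum>\<alpha><N. c \<alpha> * W \<alpha> i * cnj (W \<alpha> j)) * u j)"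
proof -
  have "complex_of_real ((cmod (\<Sum>i<N. cnj (W \<alpha> i) * u i))\<^sup>2 * c \<alpha>)
      = (\<Sum>i<N. \<Sum>j<N. cnj (u i) * (c \<alpha> * W \<alpha> i * cnj (W \<alpha> j)) * u j)" for \<alpha>
  proof -
    have "complex_of_real ((cmod (\<Sum>i<N. cnj (W \<alpha> i) * u i))\<^sup>2 * c \<alpha>)
        = (\<Sum>i<N. W \<alpha> i * cnj (u i)) * (\<Sum>j<N. cnj (W \<alpha> j) * u j) * c \<alpha>"
      by (simp add: complex_norm_square mult_ac del: of_real_power)
    thus ?thesis unfolding sum_product by (simp add: sum_distrib_left sum_distrib_right mult_ac)
  qed
  hence "of_real (\<Sum>\<alpha><N. (cmod (\<Sum>i<N. cnj (W \<alpha> i) * u i))\<^sup>2 * c \<alpha>)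
      = (\<Sum>\<alpha><N. \<Sum>i<N. \<Sum>j<N. cnj (u i) * (c \<alpha> * W \<alpha> i * cnj (W \<alpha> j)) * u j)"
    by (simp only: of_real_sum)
  also have "\<dots> = (\<Sum>i<N. \<Sum>j<N. \<Sum>\<alpha><N. cnj (u i) * (c \<alpha> * W \<alpha> i * cnj (W \<alpha> j)) * u j)"
    by (subst sum.swap, rule sum.cong[OF refl], rule sum.swap)
  finally show ?thesis by (simp add: sum_distrib_left sum_distrib_right)
qed

text \<open>This is how independence of tensor factors enters: if an index amounts to a free choice
  of one coordinate per factor, a sum of products over indices is a product of sums.\<close>

lemma sum_prod_reindex:
  fixes f :: "'i \<Rightarrow> nat \<Rightarrow> 'c :: comm_semiring_1"
  assumes "finite I" "\<And>j. j \<in> I \<Longrightarrow> finite (B j)" "bij_betw \<phi> S (PiE I B)"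
  shows "(\<Sum>i\<in>S. \<Prod>j\<in>I. f j (\<phi> i j)) = (\<Prod>j\<in>I. \<Sum>a\<in>B j. f j a)"
  using sum.reindex_bij_betw[OF assms(3), of "\<lambda>g. \<Prod>j\<in>I. f j (g j)"] prod_sum_PiE[OF assms(1,2), where f = f]
  by simp

text \<open>\<open>X j\<close> acts on the tensor factor \<open>j\<close> only and is diagonal in the product basis built from the
  \<open>w j\<close>; Jensen's inequality is applied to the distribution of an orthonormal vector over that basis.\<close>

lemma sum_exp_product_basis:
  fixes u :: "nat \<Rightarrow> nat \<Rightarrow> complex" and w :: "'i \<Rightarrow> nat \<Rightarrow> nat \<Rightarrow> complex" and \<beta> :: "'i \<Rightarrow> nat \<Rightarrow> real"
    and \<phi> :: "nat \<Rightarrow> 'i \<Rightarrow> nat" and q :: "'i \<Rightarrow> nat"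
  assumes I: "finite I" and \<phi>: "bij_betw \<phi> {..<N} (PiE I (\<lambda>j. {..<q j}))"
    and w: "\<And>j. j \<in> I \<Longrightarrow> orthonormal_basis (q j) (w j)"
    and u: "orthonormal_basis N u"
  defines "X \<equiv> \<lambda>j i i'. if \<forall>l\<in>I - {j}. \<phi> i l = \<phi> i' l
      then \<Sum>a<q j. \<beta> j a * (w j a (\<phi> i j) * cnj (w j a (\<phi> i' j))) else 0"
  shows "(\<Sum>k<N. exp (\<Sum>j\<in>I. Re (\<Sum>i<N. \<Sum>i'<N. cnj (u k i) * X j i i' * u k i')))
    \<le> (\<Prod>j\<in>I. \<Sum>a<q j. exp (\<beta> j a))"
proof -
  have \<phi>q: "\<phi> i j < q j" if "i < N" "j \<in> I" for i j
    using bij_betwE[OF \<phi>] that by auto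
  have \<phi>eq: "(\<forall>l\<in>I. \<phi> i l = \<phi> j l) \<longleftrightarrow> i = j" if "i < N" "j < N" for i j
  proof
    assume *: "\<forall>l\<in>I. \<phi> i l = \<phi> j l"
    have "\<phi> i \<in> PiE I (\<lambda>j. {..<q j})" "\<phi> j \<in> PiE I (\<lambda>j. {..<q j})" using bij_betwE[OF \<phi>] that by auto
    hence "\<phi> i = \<phi> j" using * by (metis PiE_ext)
    thus "i = j" using \<phi> that by (auto simp: bij_betw_def inj_on_def)
  qed auto
  \<comment> \<open>The vectors \<open>W \<alpha>\<close> form the product basis and
    \<open>p k\<close> is the distribution of the outcome when \<open>u k\<close> is measured in
    it.\<close>
  define W where "W = (\<lambda>\<alpha> i. \<Prod>j\<in>I. w j (\<phi> \<alpha> j) (\<phi> i j))"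
  define p where "p = (\<lambda>k \<alpha>. (cmod (\<Sum>i<N. cnj (W \<alpha> i) * u k i))\<^sup>2)"
  note prod = sum_prod_reindex[OF I _ \<phi>]
  have WX: "(\<Sum>\<alpha><N. \<beta> j (\<phi> \<alpha> j) * W \<alpha> i * cnj (W \<alpha> i')) = X j i i'"
    if "i < N" "i' < N" "j \<in> I" for i i' j
  proof -
    have "(\<Sum>\<alpha><N. \<beta> j (\<phi> \<alpha> j) * W \<alpha> i * cnj (W \<alpha> i'))
        = (\<Sum>\<alpha><N. \<Prod>l\<in>I. (if l = j then complex_of_real (\<beta> j (\<phi> \<alpha> l)) else 1)
              * (w l (\<phi> \<alpha> l) (\<phi> i l) * cnj (w l (\<phi> \<alpha> l) (\<phi> i' l))))"
      using I that by (simp add: W_def prod.distrib mult.assoc)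
    also have "\<dots> = (\<Prod>l\<in>I. \<Sum>a<q l. (if l = j then complex_of_real (\<beta> j a) else 1)
              * (w l a (\<phi> i l) * cnj (w l a (\<phi> i' l))))"
      by (rule prod) simp
    also have "\<dots> = (\<Sum>a<q j. \<beta> j a * (w j a (\<phi> i j) * cnj (w j a (\<phi> i' j)))) *
        (\<Prod>l\<in>I - {j}. \<Sum>a<q l. w l a (\<phi> i l) * cnj (w l a (\<phi> i' l)))"
      using I that by (subst prod.remove[of _ j]) auto
    also have "(\<Prod>l\<in>I - {j}. \<Sum>a<q l. w l a (\<phi> i l) * cnj (w l a (\<phi> i' l)))
        = (\<Prod>l\<in>I - {j}. if \<phi> i l = \<phi> i' l then 1 else 0)"
      by (intro prod.cong refl) (simp add: orthonormal_basisD2[OF w] \<phi>q that)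
    also have "\<dots> = (if \<forall>l\<in>I - {j}. \<phi> i l = \<phi> i' l then 1 else 0)"
      using I by (auto simp: prod_zero_iff)
    finally show ?thesis by (simp add: X_def)
  qed
  have WW: "(\<Sum>\<alpha><N. W \<alpha> i * cnj (W \<alpha> i')) = (if i = i' then 1 else 0)" if "i < N" "i' < N" for i i'
  proof -
    have "(\<Sum>\<alpha><N. W \<alpha> i * cnj (W \<alpha> i'))
        = (\<Sum>\<alpha><N. \<Prod>l\<in>I. w l (\<phi> \<alpha> l) (\<phi> i l) * cnj (w l (\<phi> \<alpha> l) (\<phi> i' l)))"
      by (simp add: W_def prod.distrib)
    also have "\<dots> = (\<Prod>l\<in>I. \<Sum>a<q l. w l a (\<phi> i l) * cnj (w l a (\<phi> i' l)))"
      by (rule prod) simp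
    also have "\<dots> = (\<Prod>l\<in>I. if \<phi> i l = \<phi> i' l then 1 else 0)"
      by (intro prod.cong refl) (simp add: orthonormal_basisD2[OF w] \<phi>q that)
    also have "\<dots> = (if \<forall>l\<in>I. \<phi> i l = \<phi> i' l then 1 else 0)"
      using I by (auto simp: prod_zero_iff)
    finally show ?thesis using \<phi>eq[OF that] by simp
  qed
  have W1: "(\<Sum>i<N. (cmod (W \<alpha> i))\<^sup>2) = 1" if "\<alpha> < N" for \<alpha>
  proof -
    have "(\<Sum>i<N. (cmod (W \<alpha> i))\<^sup>2) = (\<Sum>i<N. \<Prod>j\<in>I. (cmod (w j (\<phi> \<alpha> j) (\<phi> i j)))\<^sup>2)"
      by (simp add: W_def prod_norm prod_power_distrib flip: prod_norm)
    also have "\<dots> = (\<Prod>j\<in>I. \<Sum>a<q j. (cmod (w j (\<phi> \<alpha> j) a))\<^sup>2)"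
      by (rule prod) simp
    also have "\<dots> = 1" by (intro prod.neutral ballI sum_cmod_square_basis w \<phi>q that)
    finally show ?thesis .
  qed
  have sum_p: "(\<Sum>\<alpha><N. p k \<alpha>) = 1" if k: "k < N" for k
  proof -
    have "complex_of_real (\<Sum>\<alpha><N. p k \<alpha> * 1)
        = (\<Sum>i<N. \<Sum>j<N. cnj (u k i) * (\<Sum>\<alpha><N. complex_of_real 1 * W \<alpha> i * cnj (W \<alpha> j)) * u k j)"
      unfolding p_def by (rule weighted_overlap)
    also have "\<dots> = (\<Sum>i<N. \<Sum>j<N. if j = i then cnj (u k i) * u k i else 0)"
      by (intro sum.cong refl) (auto simp: WW)
    also have "\<dots> = 1" using orthonormal_basisD1[OF u k k] by simp
    finally show ?thesis by (simp flip: of_real_sum)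
  qed
  \<comment> \<open>With \<open>sum_p\<close> this makes \<open>p\<close> doubly stochastic: for
    uniform \<open>k\<close> the outcome \<alpha> is uniform over all tuples, so its block
    components are independent.\<close>
  have sum_p': "(\<Sum>k<N. p k \<alpha>) = 1" if \<alpha>: "\<alpha> < N" for \<alpha>
  proof -
    have "p k \<alpha> = (cmod (\<Sum>i<N. cnj (cnj (u k i)) * cnj (W \<alpha> i)))\<^sup>2 * 1" for k
      unfolding p_def by (simp add: mult.commute)
    hence "complex_of_real (\<Sum>k<N. p k \<alpha>)
        = (\<Sum>i<N. \<Sum>j<N. cnj (cnj (W \<alpha> i)) * (\<Sum>k<N. complex_of_real 1 * cnj (u k i) * cnj (cnj (u k j))) * cnj (W \<alpha> j))"
      by (simp only: weighted_overlap)
    also have "\<dots> = (\<Sum>i<N. \<Sum>j<N. if j = i then complex_of_real ((cmod (W \<alpha> i))\<^sup>2) else 0)"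
    proof (intro sum.cong refl)
      fix i j assume ij: "i \<in> {..<N}" "j \<in> {..<N}"
      have "(\<Sum>k<N. complex_of_real 1 * cnj (u k i) * cnj (cnj (u k j))) = (if j = i then 1 else 0)"
        using orthonormal_basisD2[OF u, of j i] ij by (simp add: mult.commute)
      thus "cnj (cnj (W \<alpha> i)) * (\<Sum>k<N. complex_of_real 1 * cnj (u k i) * cnj (cnj (u k j))) * cnj (W \<alpha> j)
          = (if j = i then complex_of_real ((cmod (W \<alpha> i))\<^sup>2) else 0)"
        by (simp only: complex_norm_square) simp
    qed
    also have "\<dots> = complex_of_real (\<Sum>i<N. (cmod (W \<alpha> i))\<^sup>2)" by simp
    also have "\<dots> = 1" by (simp only: W1[OF \<alpha>] of_real_1)
    finally show ?thesis by (simp only: of_real_eq_1_iff)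
  qed
  \<comment> \<open>All \<open>X j\<close> are diagonal in the basis \<open>W\<close>, with
    eigenvalue \<open>\<beta> j (\<phi> \<alpha> j)\<close> at \<alpha>; the quadratic form is
    therefore a mean under \<open>p k\<close>, to which Jensen applies.\<close>
  have mean: "(\<Sum>j\<in>I. Re (\<Sum>i<N. \<Sum>i'<N. cnj (u k i) * X j i i' * u k i'))
      = (\<Sum>\<alpha><N. p k \<alpha> * (\<Sum>j\<in>I. \<beta> j (\<phi> \<alpha> j)))" for k
  proof -
    have "Re (\<Sum>i<N. \<Sum>i'<N. cnj (u k i) * X j i i' * u k i') = (\<Sum>\<alpha><N. p k \<alpha> * \<beta> j (\<phi> \<alpha> j))"
      if j: "j \<in> I" for j
    proof -
      have "complex_of_real (\<Sum>\<alpha><N. p k \<alpha> * \<beta> j (\<phi> \<alpha> j))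
          = (\<Sum>i<N. \<Sum>i'<N. cnj (u k i) * (\<Sum>\<alpha><N. \<beta> j (\<phi> \<alpha> j) * W \<alpha> i * cnj (W \<alpha> i')) * u k i')"
        unfolding p_def by (rule weighted_overlap)
      also have "\<dots> = (\<Sum>i<N. \<Sum>i'<N. cnj (u k i) * X j i i' * u k i')"
        by (intro sum.cong refl) (simp add: WX j)
      finally show ?thesis by (metis Re_complex_of_real)
    qed
    hence "(\<Sum>j\<in>I. Re (\<Sum>i<N. \<Sum>i'<N. cnj (u k i) * X j i i' * u k i'))
        = (\<Sum>j\<in>I. \<Sum>\<alpha><N. p k \<alpha> * \<beta> j (\<phi> \<alpha> j))" by (intro sum.cong refl)
    also have "\<dots> = (\<Sum>\<alpha><N. \<Sum>j\<in>I. p k \<alpha> * \<beta> j (\<phi> \<alpha> j))" by (rule sum.swap)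
    finally show ?thesis by (simp only: sum_distrib_left)
  qed
  have "(\<Sum>k<N. exp (\<Sum>j\<in>I. Re (\<Sum>i<N. \<Sum>i'<N. cnj (u k i) * X j i i' * u k i')))
      \<le> (\<Sum>k<N. \<Sum>\<alpha><N. p k \<alpha> * exp (\<Sum>j\<in>I. \<beta> j (\<phi> \<alpha> j)))"
    unfolding mean
  proof (rule sum_mono)
    fix k assume "k \<in> {..<N}"
    hence "sum (p k) {..<N} = 1" by (simp add: sum_p)
    thus "exp (\<Sum>\<alpha><N. p k \<alpha> * (\<Sum>j\<in>I. \<beta> j (\<phi> \<alpha> j))) \<le> (\<Sum>\<alpha><N. p k \<alpha> * exp (\<Sum>j\<in>I. \<beta> j (\<phi> \<alpha> j)))"
      using exp_jensen[of "{..<N}" "p k" "\<lambda>\<alpha>. \<Sum>j\<in>I. \<beta> j (\<phi> \<alpha> j)"] by (simp add: p_def)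
  qed
  also have "\<dots> = (\<Sum>\<alpha><N. (\<Sum>k<N. p k \<alpha>) * exp (\<Sum>j\<in>I. \<beta> j (\<phi> \<alpha> j)))"
    by (subst sum.swap) (simp add: sum_distrib_right)
  also have "\<dots> = (\<Sum>\<alpha><N. \<Prod>j\<in>I. exp (\<beta> j (\<phi> \<alpha> j)))"
    by (intro sum.cong refl) (simp add: sum_p' exp_sum I)
  also have "\<dots> = (\<Prod>j\<in>I. \<Sum>a<q j. exp (\<beta> j a))"
    by (rule prod) simp
  finally show ?thesis .
qed

text \<open>The linear term is kept separate because it cancels when summed over centred values,
  leaving a Gaussian factor.\<close>

lemma exp_le_add_exp_square: "exp y \<le> y + exp (y\<^sup>2)" for y :: real
proof -
  have sq: "1 + y\<^sup>2 \<le> exp (y\<^sup>2)" by (rule exp_ge_add_one_self)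
  consider "y \<ge> 1" | "0 \<le> y" "y \<le> 1" | "-1 \<le> y" "y \<le> 0" | "y \<le> -1" by linarith
  thus ?thesis
  proof cases
    case 1
    hence "y * 1 \<le> y * y" by (intro mult_left_mono) auto
    hence "exp y \<le> exp (y\<^sup>2)" by (simp add: power2_eq_square)
    with 1 show ?thesis by linarith
  next
    case 2
    with exp_bound[of y] sq show ?thesis by linarith
  next
    case 3
    define z where "z = - y"
    have z: "0 \<le> z" "z \<le> 1" using 3 by (auto simp: z_def)
    \<comment> \<open>Multiplying out leaves 1 plus nonnegative terms, so 1 - z + z^2 dominates the
      reciprocal of the quadratic Taylor polynomial of exp z, hence exp (-z).\<close>
    have "1 \<le> (1 - z + z\<^sup>2) * (1 + z + z\<^sup>2 / 2)"
    proof -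
      have "(1 - z + z\<^sup>2) * (1 + z + z\<^sup>2 / 2) = 1 + z\<^sup>2 / 2 + z ^ 3 / 2 + z ^ 4 / 2"
        by (simp add: field_simps power2_eq_square power3_eq_cube power4_eq_xxxx)
      thus ?thesis using z by simp
    qed
    also have "\<dots> \<le> (1 - z + z\<^sup>2) * exp z"
      using exp_lower_Taylor_quadratic[OF z(1)] z by (intro mult_left_mono) auto
    finally have "exp (- z) \<le> 1 - z + z\<^sup>2" by (simp add: exp_minus field_simps)
    hence "exp y \<le> 1 + y + y\<^sup>2" by (simp add: z_def)
    with sq show ?thesis by linarith
  next
    case 4
    hence "(-y) * 1 \<le> (-y) * (-y)" by (intro mult_left_mono) auto
    hence "- y \<le> y\<^sup>2" by (simp add: power2_eq_square)
    hence "1 \<le> y + exp (y\<^sup>2)" using sq by linarith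
    moreover have "exp y \<le> 1" using 4 by simp
    ultimately show ?thesis by linarith
  qed
qed

text \<open>A Hoeffding-type bound for the uniform distribution on \<open>q\<close> points, with the
  cruder constant 1 in place of 1/2 in the exponent.\<close>

lemma sum_exp_le_centered:
  fixes \<beta> :: "nat \<Rightarrow> real"
  assumes "(\<Sum>a<q. \<beta> a) = 0" "\<And>a. a < q \<Longrightarrow> \<bar>\<beta> a\<bar> \<le> b"
  shows "(\<Sum>a<q. exp (x * \<beta> a)) \<le> q * exp (x\<^sup>2 * b\<^sup>2)"
proof -
  have "(\<Sum>a<q. exp (x * \<beta> a)) \<le> (\<Sum>a<q. x * \<beta> a + exp (x\<^sup>2 * b\<^sup>2))"
  proof (rule sum_mono)
    fix a assume a: "a \<in> {..<q}"
    have "exp (x * \<beta> a) \<le> x * \<beta> a + exp ((x * \<beta> a)\<^sup>2)" by (rule exp_le_add_exp_square)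
    also have "(x * \<beta> a)\<^sup>2 \<le> x\<^sup>2 * b\<^sup>2"
      unfolding power_mult_distrib using assms(2)[of a] a
      by (intro mult_left_mono) (auto simp: abs_le_square_iff[symmetric])
    finally show "exp (x * \<beta> a) \<le> x * \<beta> a + exp (x\<^sup>2 * b\<^sup>2)" by simp
  qed
  also have "\<dots> = q * exp (x\<^sup>2 * b\<^sup>2)"
    by (simp add: sum.distrib assms(1) flip: sum_distrib_left)
  finally show ?thesis .
qed

section \<open>Translations and blocks of sites\<close>

lemma digit_Suc:
  assumes "l < n"
  shows "digit d (Suc n) i l = digit d n (i div d) l"
proof -
  have "d ^ (n - l) = d * d ^ (n - 1 - l)"
    using assms by (simp add: Suc_diff_Suc flip: power_Suc)
  thus ?thesis by (simp add: digit_def div_mult2_eq)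
qed

lemma digit_Suc_last: "digit d (Suc n) i n = i mod d"
  by (simp add: digit_def)

lemma digit_less: "d > 0 \<Longrightarrow> digit d n i l < d"
  by (simp add: digit_def)

lemma digit_inject:
  assumes "i < d ^ n" "j < d ^ n" "\<And>l. l < n \<Longrightarrow> digit d n i l = digit d n j l"
  shows "i = j"
  using assms
proof (induction n arbitrary: i j)
  case (Suc n)
  have "d > 0" using Suc.prems(1) by (cases d) auto
  have "i div d = j div d"
  proof (rule Suc.IH)
    show "digit d n (i div d) l = digit d n (j div d) l" if "l < n" for l
      using Suc.prems(3)[of l] that by (simp add: digit_Suc)
  qed (use Suc.prems(1,2) \<open>d > 0\<close> in \<open>simp_all add: less_mult_imp_div_less mult.commute\<close>)
  moreover have "i mod d = j mod d" using Suc.prems(3)[of n] by (simp add: digit_Suc_last)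
  ultimately show ?case by (metis div_mult_mod_eq)
qed simp

lemma ex_digits:
  assumes "\<And>l. l < n \<Longrightarrow> x l < d"
  shows "\<exists>i<d ^ n. \<forall>l<n. digit d n i l = x l"
  using assms
proof (induction n)
  case (Suc n)
  then obtain i where i: "i < d ^ n" "\<forall>l<n. digit d n i l = x l" by force
  have x: "x n < d" using Suc.prems by simp
  hence "i * d + x n < d ^ Suc n"
    using mult_le_mono1[of "Suc i" "d ^ n" d] i(1) by (simp add: mult.commute)
  moreover have "digit d (Suc n) (i * d + x n) l = x l" if "l < Suc n" for l
    using that i(2) x by (cases "l = n") (simp_all add: digit_Suc_last digit_Suc)
  ultimately show ?case by blast
qed simp

text \<open>The configuration on the sites t, ..., t + w - 1, read as one number below d^w. The
  division removes the n - t - w sites to the right, since site 0 is the most significant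
  digit.\<close>

definition window :: "nat \<Rightarrow> nat \<Rightarrow> nat \<Rightarrow> nat \<Rightarrow> nat \<Rightarrow> nat" where
  "window d n t w i = (i div d ^ (n - t - w)) mod d ^ w"

lemma window_less: "d > 0 \<Longrightarrow> window d n t w i < d ^ w"
  by (simp add: window_def)

lemma digit_window:
  assumes "t + w \<le> n" "k < w"
  shows "digit d w (window d n t w i) k = digit d n i (t + k)"
proof -
  have "digit d w (x mod d ^ w) k = (x div d ^ (w - 1 - k)) mod d" for x
  proof -
    \<comment> \<open>The modulus is split at digit \<open>k\<close>: the first factor is divided
      away, and the remaining modulus is a multiple of \<open>d\<close>, so the digit
      survives.\<close>
    have "d ^ w = d ^ (w - 1 - k) * (d * d ^ k)"
      using assms(2) power_add[of d "w - 1 - k" "Suc k"] by simp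
    hence "x mod d ^ w div d ^ (w - 1 - k) = (x div d ^ (w - 1 - k)) mod (d * d ^ k)"
      by (cases "d = 0") (simp_all add: mod_mult2_eq power_0_left)
    thus ?thesis by (simp add: digit_def mod_mult2_eq)
  qed
  hence "digit d w (window d n t w i) k = (i div d ^ (n - t - w) div d ^ (w - 1 - k)) mod d"
    by (simp add: window_def)
  also have "\<dots> = digit d n i (t + k)"
    using assms by (simp add: digit_def div_mult2_eq[symmetric] flip: power_add)
  finally show ?thesis .
qed

lemma window_eq_iff:
  assumes "d > 0" "t + w \<le> n"
  shows "window d n t w i = window d n t w j \<longleftrightarrow> (\<forall>k<w. digit d n i (t + k) = digit d n j (t + k))"
proof
  assume "\<forall>k<w. digit d n i (t + k) = digit d n j (t + k)"
  thus "window d n t w i = window d n t w j"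
    using assms by (rule_tac digit_inject[of _ d w]) (simp_all add: window_less digit_window)
next
  assume "window d n t w i = window d n t w j"
  thus "\<forall>k<w. digit d n i (t + k) = digit d n j (t + k)"
    using assms by (metis digit_window)
qed

text \<open>The chain is cut into the \<open>m = n div r\<close> blocks \<open>{r * j..<r * j + r}\<close> and a remainder, which is
  block number \<open>m\<close>.\<close>

definition block_width :: "nat \<Rightarrow> nat \<Rightarrow> nat \<Rightarrow> nat" where
  "block_width n r j = (if j < n div r then r else n mod r)"

text \<open>The identification of a basis index with its tuple of block configurations. Position
  \<open>n div r\<close> is included for the remainder, which has the single configuration 0 when
  \<open>r\<close> divides \<open>n\<close>; \<open>restrict\<close> makes the tuple a member of a
  \<open>PiE\<close>.\<close>

definition blocks :: "nat \<Rightarrow> nat \<Rightarrow> nat \<Rightarrow> nat \<Rightarrow> nat \<Rightarrow> nat" where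
  "blocks d n r i = restrict (\<lambda>j. window d n (r * j) (block_width n r j) i) {..n div r}"

lemma block_end: "j \<le> n div r \<Longrightarrow> r * j + block_width n r j \<le> n"
proof (cases "j < n div r")
  case True
  hence "r * (j + 1) \<le> r * (n div r)" by (intro mult_le_mono2) simp
  also have "\<dots> \<le> n" by simp
  finally show ?thesis using True by (simp add: block_width_def)
next
  case False
  moreover assume "j \<le> n div r"
  ultimately have "j = n div r" by simp
  thus ?thesis by (simp add: block_width_def)
qed

lemma blocks_eq_iff:
  assumes "d > 0" "j \<le> n div r"
  shows "blocks d n r i j = blocks d n r i' j \<longleftrightarrow>
    (\<forall>k<block_width n r j. digit d n i (r * j + k) = digit d n i' (r * j + k))"
  using assms block_end[OF assms(2)] by (simp add: blocks_def window_eq_iff)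

lemma block_of_site:
  assumes "r > 0" "l < n"
  shows "l div r \<le> n div r" "l mod r < block_width n r (l div r)"
proof -
  show le: "l div r \<le> n div r" using assms by (simp add: div_le_mono)
  show "l mod r < block_width n r (l div r)"
  proof (cases "l div r < n div r")
    case False
    with le have "l div r = n div r" by simp
    thus ?thesis using assms(2) by (simp add: block_width_def) (metis add_less_cancel_left mult_div_mod_eq)
  qed (use assms(1) in \<open>simp add: block_width_def\<close>)
qed

text \<open>Every site lies in some block, so the tuple determines all digits and the map is
  injective. The block widths add up to \<open>n\<close>, so domain and target have the same size
  and surjectivity follows.\<close>

lemma bij_betw_blocks:
  assumes "d > 0" "r > 0"
  shows "bij_betw (blocks d n r) {..<d ^ n} (PiE {..n div r} (\<lambda>j. {..<d ^ block_width n r j}))"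
proof -
  have inj: "inj_on (blocks d n r) {..<d ^ n}"
  proof (rule inj_onI)
    fix i i' assume *: "i \<in> {..<d ^ n}" "i' \<in> {..<d ^ n}" "blocks d n r i = blocks d n r i'"
    show "i = i'"
    proof (rule digit_inject[of _ d n])
      fix l assume l: "l < n"
      have "r * (l div r) + l mod r = l" by simp
      thus "digit d n i l = digit d n i' l"
        using *(3) blocks_eq_iff[OF assms(1) block_of_site(1)[OF assms(2) l], of i i']
          block_of_site(2)[OF assms(2) l] by metis
    qed (use * in auto)
  qed
  have sub: "blocks d n r ` {..<d ^ n} \<subseteq> PiE {..n div r} (\<lambda>j. {..<d ^ block_width n r j})"
    by (intro image_subsetI PiE_I) (simp_all add: blocks_def window_less assms)
  have "card (PiE {..n div r} (\<lambda>j. {..<d ^ block_width n r j})) = (\<Prod>j\<le>n div r. d ^ block_width n r j)"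
    by (simp add: card_PiE)
  also have "\<dots> = d ^ (\<Sum>j\<le>n div r. block_width n r j)" by (simp add: power_sum)
  also have "(\<Sum>j\<le>n div r. block_width n r j) = (\<Sum>j<n div r. block_width n r j) + block_width n r (n div r)"
    by (simp add: lessThan_Suc_atMost[symmetric])
  also have "\<dots> = (n div r) * r + n mod r" by (simp add: block_width_def)
  also have "\<dots> = n" by simp
  finally have "card (PiE {..n div r} (\<lambda>j. {..<d ^ block_width n r j})) = card (blocks d n r ` {..<d ^ n})"
    using card_image[OF inj] by simp
  hence "blocks d n r ` {..<d ^ n} = PiE {..n div r} (\<lambda>j. {..<d ^ block_width n r j})"
    by (intro card_subset_eq sub finite_PiE) auto
  thus ?thesis using inj by (simp add: bij_betw_def)
qed

text \<open>The direction is chosen so that row \<open>i\<close> of \<open>transl\<close> has its 1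
  in column \<open>\<tau> i\<close>: translation acts on amplitudes by composition with \<tau>,
  which on configurations is the inverse shift.\<close>

definition is_rotation :: "nat \<Rightarrow> nat \<Rightarrow> (nat \<Rightarrow> nat) \<Rightarrow> bool" where
  "is_rotation d n \<tau> \<longleftrightarrow> bij_betw \<tau> {..<d ^ n} {..<d ^ n} \<and>
     (\<forall>i<d ^ n. \<forall>l<n. digit d n (\<tau> i) l = digit d n i ((l + 1) mod n))"

text \<open>The shifted digit string belongs to some index; the cyclic shift can be undone, which
  gives injectivity and, on a finite set, bijectivity.\<close>

lemma ex_rotation:
  assumes "d > 0"
  obtains \<tau> where "is_rotation d n \<tau>"
proof -
  have "\<exists>j. j < d ^ n \<and> (\<forall>l<n. digit d n j l = digit d n i ((l + 1) mod n))" for i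
    using ex_digits[of n "\<lambda>l. digit d n i ((l + 1) mod n)" d] digit_less[OF assms] by blast
  then obtain \<tau> where \<tau>: "\<And>i. \<tau> i < d ^ n" "\<And>i l. l < n \<Longrightarrow> digit d n (\<tau> i) l = digit d n i ((l + 1) mod n)"
    by metis
  have "inj_on \<tau> {..<d ^ n}"
  proof (rule inj_onI)
    fix i j assume ij: "i \<in> {..<d ^ n}" "j \<in> {..<d ^ n}" "\<tau> i = \<tau> j"
    show "i = j"
    proof (rule digit_inject[of _ d n])
      fix l assume l: "l < n"
      have "((l + n - 1) mod n + 1) mod n = l"
        using l by (cases l) (simp_all add: mod_simps)
      thus "digit d n i l = digit d n j l"
        using \<tau>(2)[of "(l + n - 1) mod n" i] \<tau>(2)[of "(l + n - 1) mod n" j] ij(3) l by simp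
    qed (use ij in auto)
  qed
  moreover have "\<tau> ` {..<d ^ n} \<subseteq> {..<d ^ n}" using \<tau>(1) by auto
  ultimately have "bij_betw \<tau> {..<d ^ n} {..<d ^ n}"
    by (simp add: bij_betw_def endo_inj_surj)
  with \<tau>(2) show thesis by (intro that[of \<tau>]) (simp add: is_rotation_def)
qed

lemma rotation_less: "is_rotation d n \<tau> \<Longrightarrow> i < d ^ n \<Longrightarrow> \<tau> i < d ^ n"
  by (auto simp: is_rotation_def bij_betw_def)

lemma rotation_funpow_less: "is_rotation d n \<tau> \<Longrightarrow> i < d ^ n \<Longrightarrow> (\<tau> ^^ p) i < d ^ n"
  by (induction p) (simp_all add: rotation_less)

lemma digit_rotation_funpow:
  assumes "is_rotation d n \<tau>" "i < d ^ n" "l < n"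
  shows "digit d n ((\<tau> ^^ p) i) l = digit d n i ((l + p) mod n)"
  using assms(3)
proof (induction p arbitrary: l)
  case (Suc p)
  have "digit d n ((\<tau> ^^ Suc p) i) l = digit d n ((\<tau> ^^ p) i) ((l + 1) mod n)"
    using assms(1) rotation_funpow_less[OF assms(1,2)] Suc.prems by (simp add: is_rotation_def)
  also have "\<dots> = digit d n i (((l + 1) mod n + p) mod n)"
    using Suc.prems by (intro Suc.IH) simp
  finally show ?case by (simp add: mod_simps)
qed simp

lemma transl_eq:
  assumes "is_rotation d n \<tau>" "i < d ^ n" "j < d ^ n"
  shows "transl d n $$ (i, j) = (if j = \<tau> i then 1 else 0)"
proof -
  have "(\<forall>l<n. digit d n i l = digit d n j ((l + n - 1) mod n)) \<longleftrightarrow> j = \<tau> i"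
  proof
    assume *: "\<forall>l<n. digit d n i l = digit d n j ((l + n - 1) mod n)"
    show "j = \<tau> i"
    proof (rule digit_inject[of _ d n])
      fix l assume l: "l < n"
      have "((l + 1) mod n + n - 1) mod n = l"
        using l by (cases "l + 1 = n") (simp_all add: mod_simps)
      thus "digit d n j l = digit d n (\<tau> i) l"
        using *[rule_format, of "(l + 1) mod n"] assms l by (simp add: is_rotation_def)
    qed (use assms rotation_less in auto)
  next
    assume "j = \<tau> i"
    moreover have "((l + n - 1) mod n + 1) mod n = l" if "l < n" for l
      using that by (cases l) (simp_all add: mod_simps)
    ultimately show "\<forall>l<n. digit d n i l = digit d n j ((l + n - 1) mod n)"
      using assms by (simp add: is_rotation_def)
  qed
  thus ?thesis using assms by (simp add: transl_def)
qed

text \<open>Compare the entry at row \<open>i\<close> and column \<open>\<tau> j\<close> of the two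
  products: multiplication by \<open>transl\<close> on one side leaves H(i, j), on the other
  H(\<tau> i, \<tau> j).\<close>

lemma commuting_rotation_invariant:
  assumes H: "H \<in> carrier_mat (d ^ n) (d ^ n)" and comm: "H * transl d n = transl d n * H"
    and \<tau>: "is_rotation d n \<tau>" and ij: "i < d ^ n" "j < d ^ n"
  shows "H $$ (\<tau> i, \<tau> j) = H $$ (i, j)"
proof -
  have T: "transl d n \<in> carrier_mat (d ^ n) (d ^ n)" by (simp add: transl_def)
  note lt = rotation_less[OF \<tau> ij(1)] rotation_less[OF \<tau> ij(2)]
  have inj: "\<tau> j = \<tau> m \<longleftrightarrow> j = m" if "m < d ^ n" for m
    using \<tau> ij that by (auto simp: is_rotation_def bij_betw_def inj_on_def)
  have "(H * transl d n) $$ (i, \<tau> j) = (\<Sum>m<d ^ n. H $$ (i, m) * transl d n $$ (m, \<tau> j))"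
    using H T ij lt by (simp add: scalar_prod_def atLeast0LessThan)
  also have "\<dots> = (\<Sum>m<d ^ n. if m = j then H $$ (i, j) else 0)"
    by (intro sum.cong refl) (use ij lt in \<open>auto simp: transl_eq[OF \<tau>] inj\<close>)
  also have "\<dots> = H $$ (i, j)" using ij by simp
  finally have 1: "(H * transl d n) $$ (i, \<tau> j) = H $$ (i, j)" .
  have "(transl d n * H) $$ (i, \<tau> j) = (\<Sum>m<d ^ n. transl d n $$ (i, m) * H $$ (m, \<tau> j))"
    using H T ij lt by (simp add: scalar_prod_def atLeast0LessThan)
  also have "\<dots> = (\<Sum>m<d ^ n. if m = \<tau> i then H $$ (\<tau> i, \<tau> j) else 0)"
    by (intro sum.cong refl) (use ij lt in \<open>auto simp: transl_eq[OF \<tau>]\<close>)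
  also have "\<dots> = H $$ (\<tau> i, \<tau> j)" using lt by simp
  finally show ?thesis using 1 comm by simp
qed

section \<open>Expectation values and the transport of a local operator along the chain\<close>

definition quad_form :: "nat \<Rightarrow> (nat \<Rightarrow> complex) \<Rightarrow> (nat \<Rightarrow> nat \<Rightarrow> complex) \<Rightarrow> complex" where
  "quad_form N u g = (\<Sum>i<N. \<Sum>j<N. cnj (u i) * g i j * u j)"

lemma quad_form_cong:
  "(\<And>i j. i < N \<Longrightarrow> j < N \<Longrightarrow> g i j = g' i j) \<Longrightarrow> quad_form N u g = quad_form N u g'"
  unfolding quad_form_def by (intro sum.cong refl) simp

text \<open>The phase appears once conjugated and once not, hence cancels: an eigenvector of the
  translation cannot distinguish an operator from its translates.\<close>

lemma quad_form_permute:
  assumes "bij_betw \<tau> {..<N} {..<N}" "cmod \<mu> = 1" "\<forall>i<N. u (\<tau> i) = \<mu> * u i"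
  shows "quad_form N u g = quad_form N u (\<lambda>i j. g (\<tau> i) (\<tau> j))"
proof -
  have \<mu>: "cnj \<mu> * \<mu> = 1" using assms(2) complex_norm_square[of \<mu>] by (simp add: mult.commute)
  have "quad_form N u g = (\<Sum>i<N. \<Sum>j<N. cnj (u (\<tau> i)) * g (\<tau> i) j * u j)"
    unfolding quad_form_def by (rule sum.reindex_bij_betw[OF assms(1), symmetric])
  also have "\<dots> = (\<Sum>i<N. \<Sum>j<N. cnj (u (\<tau> i)) * g (\<tau> i) (\<tau> j) * u (\<tau> j))"
    by (rule sum.cong[OF refl], rule sum.reindex_bij_betw[OF assms(1), symmetric])
  also have "\<dots> = (\<Sum>i<N. \<Sum>j<N. (cnj \<mu> * \<mu>) * (cnj (u i) * g (\<tau> i) (\<tau> j) * u j))"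
    by (intro sum.cong refl) (use assms(3) in simp)
  finally show ?thesis by (simp add: \<mu> quad_form_def)
qed

lemma quad_form_permute_funpow:
  assumes "bij_betw \<tau> {..<N} {..<N}" "cmod \<mu> = 1" "\<forall>i<N. u (\<tau> i) = \<mu> * u i"
  shows "quad_form N u g = quad_form N u (\<lambda>i j. g ((\<tau> ^^ p) i) ((\<tau> ^^ p) j))"
proof (induction p)
  case (Suc p)
  show ?case
    unfolding Suc quad_form_permute[OF assms, of "\<lambda>i j. g ((\<tau> ^^ p) i) ((\<tau> ^^ p) j)"]
    by (simp add: funpow_swap1)
qed simp

text \<open>The expectation of the adjoint is the complex conjugate. A general \<open>A\<close> can
  thus be replaced by a Hermitian operator, which has an orthonormal eigenbasis, at the price of
  controlling only one real direction \<open>c\<close>.\<close>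

lemma Re_quad_form_hermitian_part:
  "Re (quad_form N u (\<lambda>i j. (c * g i j + cnj (c * g j i)) / 2)) = Re (c * quad_form N u g)"
proof -
  define z where "z = c * quad_form N u g"
  have "cnj z = (\<Sum>i<N. \<Sum>j<N. u i * cnj (c * g i j) * cnj (u j))"
    by (simp add: z_def quad_form_def sum_distrib_left mult_ac)
  also have "\<dots> = quad_form N u (\<lambda>i j. cnj (c * g j i))"
    unfolding quad_form_def by (subst sum.swap) (simp add: mult_ac)
  finally have cnj_z: "cnj z = quad_form N u (\<lambda>i j. cnj (c * g j i))" .
  have z: "z = quad_form N u (\<lambda>i j. c * g i j)"
    by (simp add: z_def quad_form_def sum_distrib_left mult_ac)
  have "quad_form N u (\<lambda>i j. (a i j + b i j) / 2) = (quad_form N u a + quad_form N u b) / 2" for a b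
    unfolding quad_form_def sum.distrib[symmetric] sum_divide_distrib
    by (intro sum.cong refl) (simp add: field_simps)
  hence "quad_form N u (\<lambda>i j. (c * g i j + cnj (c * g j i)) / 2) = (z + cnj z) / 2"
    by (simp only: z[symmetric] cnj_z[symmetric])
  hence "Re (quad_form N u (\<lambda>i j. (c * g i j + cnj (c * g j i)) / 2)) = Re ((z + cnj z) / 2)"
    by (simp only:)
  also have "\<dots> = Re z" by simp
  finally show ?thesis by (simp only: z_def)
qed

text \<open>A shift by t - s carries the cyclic window at \<open>s\<close> to the one at
  \<open>t\<close>. The added \<open>n\<close> keeps the difference a natural number, and
  \<open>t + r \<le> n\<close> makes the target an ordinary interval without wrap-around.\<close>

lemma mod_add_shift_window:
  fixes n s t r l :: nat
  assumes s: "s < n" and t: "t + r \<le> n" and l: "l < n"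
  shows "l \<in> {(s + k) mod n | k. k < r} \<longleftrightarrow> (l + (n + t - s)) mod n \<in> {t..<t + r}"
proof
  assume "l \<in> {(s + k) mod n | k. k < r}"
  then obtain k where k: "k < r" "l = (s + k) mod n" by blast
  have "(l + (n + t - s)) mod n = (s + k + (n + t - s)) mod n" by (simp add: k mod_simps)
  also have "s + k + (n + t - s) = t + k + n" using s by simp
  also have "(t + k + n) mod n = t + k" using k t by simp
  finally show "(l + (n + t - s)) mod n \<in> {t..<t + r}" using k by simp
next
  assume *: "(l + (n + t - s)) mod n \<in> {t..<t + r}"
  define k where "k = (l + (n + t - s)) mod n - t"
  have k: "k < r" "t + k = (l + (n + t - s)) mod n" using * by (auto simp: k_def)
  have "(s + (t + k)) mod n = (s + (l + (n + t - s))) mod n" unfolding k(2) by (simp add: mod_simps)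
  also have "s + (l + (n + t - s)) = (l + t) + n" using s by simp
  also have "(l + t + n) mod n = (l + t) mod n" by simp
  also have "s + (t + k) = s + k + t" by simp
  finally have "(s + k + t) mod n = (l + t) mod n" .
  hence "((s + k + t) mod n + e) mod n = ((l + t) mod n + e) mod n" for e by (simp only:)
  hence "(s + k + t + (n - t)) mod n = (l + t + (n - t)) mod n" by (simp only: mod_add_left_eq)
  moreover have "s + k + t + (n - t) = s + k + n" "l + t + (n - t) = l + n" using t by simp_all
  ultimately have "(s + k) mod n = l mod n" by simp
  thus "l \<in> {(s + k) mod n | k. k < r}" using l k(1) by auto
qed

text \<open>Turns \<open>b\<close>, which takes configurations as functions, into a matrix indexed
  by numbers below d^r, to which the spectral theorem applies.\<close>

definition local_coeff :: "nat \<Rightarrow> nat \<Rightarrow> ((nat \<Rightarrow> nat) \<Rightarrow> (nat \<Rightarrow> nat) \<Rightarrow> complex) \<Rightarrow> nat \<Rightarrow> nat \<Rightarrow> complex" where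
  "local_coeff d r b P Q = b (restrict (digit d r P) {..<r}) (restrict (digit d r Q) {..<r})"

lemma restrict_digit_window:
  "t + r \<le> n \<Longrightarrow> restrict (digit d r (window d n t r i)) {..<r} = restrict (\<lambda>k. digit d n i (t + k)) {..<r}"
  by (intro restrict_ext) (simp add: digit_window)

text \<open>The support may wrap around the end of the chain; \<open>p\<close> rotations move it
  onto the interval starting at \<open>t\<close>, with the same coefficients
  \<open>b\<close>.\<close>

lemma local_rotated:
  fixes A :: "complex mat"
  assumes \<tau>: "is_rotation d n \<tau>" and s: "s < n" and t: "t + r \<le> n"
    and A: "\<forall>i<d ^ n. \<forall>j<d ^ n. A $$ (i, j) =
        (if (\<forall>l<n. l \<notin> {(s + k) mod n | k. k < r} \<longrightarrow> digit d n i l = digit d n j l)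
         then b (restrict (\<lambda>k. digit d n i ((s + k) mod n)) {..<r})
                (restrict (\<lambda>k. digit d n j ((s + k) mod n)) {..<r})
         else 0)"
    and ij: "i < d ^ n" "j < d ^ n"
  defines "p \<equiv> n + t - s"
  shows "A $$ ((\<tau> ^^ p) i, (\<tau> ^^ p) j) =
    (if \<forall>l<n. l \<notin> {t..<t + r} \<longrightarrow> digit d n i l = digit d n j l
     then local_coeff d r b (window d n t r i) (window d n t r j) else 0)"
proof -
  note dg = digit_rotation_funpow[OF \<tau> ij(1)] digit_rotation_funpow[OF \<tau> ij(2)]
  have "(\<forall>l<n. l \<notin> {(s + k) mod n | k. k < r} \<longrightarrow> digit d n ((\<tau> ^^ p) i) l = digit d n ((\<tau> ^^ p) j) l)
      \<longleftrightarrow> (\<forall>l<n. (l + p) mod n \<notin> {t..<t + r} \<longrightarrow> digit d n i ((l + p) mod n) = digit d n j ((l + p) mod n))"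
    using mod_add_shift_window[OF s t] by (simp only: dg p_def cong: imp_cong)
  also have "\<dots> \<longleftrightarrow> (\<forall>l<n. l \<notin> {t..<t + r} \<longrightarrow> digit d n i l = digit d n j l)"
  proof (intro iffI allI impI)
    fix l assume *: "\<forall>l<n. (l + p) mod n \<notin> {t..<t + r} \<longrightarrow> digit d n i ((l + p) mod n) = digit d n j ((l + p) mod n)"
      and l: "l < n" "l \<notin> {t..<t + r}"
    \<comment> \<open>The preimage of \<open>l\<close> under the shift by \<open>p\<close>: the two
      shifts add up to 2 n.\<close>
    define l' where "l' = (l + (s + n - t)) mod n"
    have "(l' + p) mod n = (l + (s + n - t) + p) mod n" by (simp add: l'_def mod_simps)
    also have "l + (s + n - t) + p = l + n + n" using s t by (simp add: p_def)
    also have "(l + n + n) mod n = l" using l by simp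
    finally have "(l' + p) mod n = l" .
    moreover have "l' < n" using s by (simp add: l'_def)
    ultimately show "digit d n i l = digit d n j l" using *[rule_format, of l'] l by simp
  next
    fix l assume "\<forall>l<n. l \<notin> {t..<t + r} \<longrightarrow> digit d n i l = digit d n j l" "l < n" "(l + p) mod n \<notin> {t..<t + r}"
    thus "digit d n i ((l + p) mod n) = digit d n j ((l + p) mod n)" by simp
  qed
  finally have cond: "(\<forall>l<n. l \<notin> {(s + k) mod n | k. k < r} \<longrightarrow> digit d n ((\<tau> ^^ p) i) l = digit d n ((\<tau> ^^ p) j) l)
      \<longleftrightarrow> (\<forall>l<n. l \<notin> {t..<t + r} \<longrightarrow> digit d n i l = digit d n j l)" .
  have pos: "((s + k) mod n + p) mod n = t + k" if "k < r" for k
  proof -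
    have "((s + k) mod n + p) mod n = (s + k + p) mod n" by (simp add: mod_simps)
    also have "s + k + p = t + k + n" using s by (simp add: p_def)
    finally show ?thesis using that t by simp
  qed
  have res: "restrict (\<lambda>k. digit d n ((\<tau> ^^ p) x) ((s + k) mod n)) {..<r} = restrict (digit d r (window d n t r x)) {..<r}"
    if "x < d ^ n" for x
    unfolding restrict_digit_window[OF t]
    using s by (intro restrict_ext) (simp add: digit_rotation_funpow[OF \<tau> that] pos)
  have "(\<tau> ^^ p) i < d ^ n" "(\<tau> ^^ p) j < d ^ n" using rotation_funpow_less[OF \<tau>] ij by auto
  with A[rule_format, OF this] show ?thesis
    by (simp only: cond res ij local_coeff_def)
qed

section \<open>Local operators in block coordinates, entries and spectra\<close>

lemma div_block_eq:
  fixes r j l :: nat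
  assumes "r > 0"
  shows "l \<in> {r * j..<r * j + r} \<longleftrightarrow> l div r = j"
proof
  assume "l \<in> {r * j..<r * j + r}"
  thus "l div r = j" by (intro div_nat_eqI) (auto simp: mult.commute)
next
  assume "l div r = j"
  moreover have "r * (l div r) + l mod r = l" by simp
  ultimately show "l \<in> {r * j..<r * j + r}"
    using mod_less_divisor[OF assms, of l] by (simp only: atLeastLessThan_iff) linarith
qed

text \<open>Rewrites acting as the identity off one block from sites to block coordinates, the form
  in which the bound for product bases expects its operators.\<close>

lemma agree_off_block_iff:
  assumes d: "d > 0" and r: "r > 0" and j: "j < n div r"
  shows "(\<forall>l<n. l \<notin> {r * j..<r * j + r} \<longrightarrow> digit d n i l = digit d n i' l) \<longleftrightarrow>
    (\<forall>j'\<in>{..n div r} - {j}. blocks d n r i j' = blocks d n r i' j')"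
proof (intro iffI ballI allI impI)
  fix j' assume *: "\<forall>l<n. l \<notin> {r * j..<r * j + r} \<longrightarrow> digit d n i l = digit d n i' l" and j': "j' \<in> {..n div r} - {j}"
  have "digit d n i (r * j' + k) = digit d n i' (r * j' + k)" if k: "k < block_width n r j'" for k
  proof -
    have "block_width n r j' \<le> r" using r by (simp add: block_width_def less_imp_le)
    hence "(r * j' + k) div r = j'" using k r by simp
    hence "r * j' + k \<notin> {r * j..<r * j + r}" using j' by (simp only: div_block_eq[OF r]) simp
    moreover have "r * j' + k < n" using block_end[of j' n r] j' k by simp
    ultimately show ?thesis using * by blast
  qed
  thus "blocks d n r i j' = blocks d n r i' j'" using j' by (simp add: blocks_eq_iff d)
next
  fix l assume *: "\<forall>j'\<in>{..n div r} - {j}. blocks d n r i j' = blocks d n r i' j'" and l: "l < n" "l \<notin> {r * j..<r * j + r}"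
  have "blocks d n r i (l div r) = blocks d n r i' (l div r)"
    using * block_of_site(1)[OF r l(1)] l(2) by (simp only: div_block_eq[OF r]) simp
  hence "digit d n i (r * (l div r) + l mod r) = digit d n i' (r * (l div r) + l mod r)"
    using block_of_site[OF r l(1)] by (simp only: blocks_eq_iff[OF d])
  thus "digit d n i l = digit d n i' l" by simp
qed

text \<open>An entry is a component of the image of a standard basis vector.\<close>

lemma cmod_entry_le_op_norm:
  assumes A: "A \<in> carrier_mat N N" and ij: "i < N" "j < N"
  shows "cmod (A $$ (i, j)) \<le> op_norm A"
proof -
  define R where "R = (\<lambda>i. \<Sum>j<N. cmod (A $$ (i, j)))"
  have "vnorm (A *\<^sub>v v) \<le> sqrt (\<Sum>i<N. (R i)\<^sup>2)" if v: "v \<in> carrier_vec N" "vnorm v \<le> 1" for v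
  proof -
    have v1: "cmod (v $ j) \<le> 1" if "j < N" for j
    proof -
      have "(cmod (v $ j))\<^sup>2 \<le> (\<Sum>i<N. (cmod (v $ i))\<^sup>2)"
        by (rule member_le_sum) (use that in auto)
      also have "\<dots> \<le> 1" using v by (simp add: vnorm_def)
      finally show ?thesis by (simp add: abs_square_le_1)
    qed
    have "cmod ((A *\<^sub>v v) $ i) \<le> R i" if "i < N" for i
    proof -
      have "cmod ((A *\<^sub>v v) $ i) = cmod (\<Sum>j<N. A $$ (i, j) * v $ j)"
        using A v that by (simp add: scalar_prod_def atLeast0LessThan)
      also have "\<dots> \<le> (\<Sum>j<N. cmod (A $$ (i, j) * v $ j))" by (rule norm_sum)
      also have "\<dots> \<le> R i" unfolding R_def
        by (intro sum_mono) (simp add: norm_mult v1 mult_left_le)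
      finally show ?thesis .
    qed
    thus ?thesis using A by (auto simp: vnorm_def intro!: sum_mono power_mono)
  qed
  \<comment> \<open>\<open>op_norm\<close> is a supremum of reals, so it dominates its members only
    once the set is known to be bounded; row sums give a crude bound.\<close>
  hence bdd: "bdd_above {vnorm (A *\<^sub>v v) | v. v \<in> carrier_vec (dim_col A) \<and> vnorm v \<le> 1}"
    using A by (intro bdd_aboveI[of _ "sqrt (\<Sum>i<N. (R i)\<^sup>2)"]) auto
  define e where "e = vec N (\<lambda>k. if k = j then 1 else 0 :: complex)"
  have "vnorm e = sqrt (\<Sum>k<N. if k = j then 1 else 0)"
    unfolding vnorm_def e_def by (intro arg_cong[where f = sqrt] sum.cong) auto
  hence e: "vnorm e \<le> 1" "e \<in> carrier_vec N" using ij by (auto simp: e_def)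
  have Ae: "(A *\<^sub>v e) $ k = A $$ (k, j)" if "k < N" for k
  proof -
    have "(A *\<^sub>v e) $ k = (\<Sum>l<N. A $$ (k, l) * (if l = j then 1 else 0))"
      using A that by (simp add: scalar_prod_def atLeast0LessThan e_def)
    also have "\<dots> = (\<Sum>l<N. if l = j then A $$ (k, j) else 0)" by (intro sum.cong refl) auto
    finally show ?thesis using ij by simp
  qed
  have "cmod (A $$ (i, j)) = sqrt ((cmod ((A *\<^sub>v e) $ i))\<^sup>2)" using ij by (simp add: Ae)
  also have "\<dots> \<le> vnorm (A *\<^sub>v e)" unfolding vnorm_def using A ij
    by (intro real_sqrt_le_mono member_le_sum) auto
  also have "\<dots> \<le> op_norm A" unfolding op_norm_def using e A by (intro cSup_upper bdd) auto
  finally show ?thesis .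
qed

text \<open>Serves as the basis of the remainder block, on which no copy of \<open>A\<close>
  acts.\<close>

lemma orthonormal_basis_standard: "orthonormal_basis N (\<lambda>a p. if a = p then 1 else 0)"
proof -
  have "(\<Sum>i<N. cnj (if k = i then 1 else 0) * (if l = i then 1 else 0)) = (\<Sum>i<N. if i = k then (if k = l then 1 else 0 :: complex) else 0)"
    for k l by (intro sum.cong refl) auto
  moreover have "(\<Sum>i<N. (if i = k then 1 else 0) * cnj (if i = l then 1 else 0)) = (\<Sum>i<N. if i = k then (if k = l then 1 else 0 :: complex) else 0)"
    for k l by (intro sum.cong refl) auto
  ultimately show ?thesis by (simp add: orthonormal_basis_def)
qed

lemma spectral_decomposition_trace:
  assumes "spectral_decomposition N h u eig"
  shows "(\<Sum>i<N. h i i) = of_real (\<Sum>k<N. eig k)"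
proof -
  have "(\<Sum>i<N. h i i) = (\<Sum>i<N. \<Sum>k<N. eig k * (cnj (u k i) * u k i))"
    by (intro sum.cong refl) (simp add: spectral_decompositionD3[OF assms] mult_ac)
  also have "\<dots> = (\<Sum>k<N. eig k * (\<Sum>i<N. cnj (u k i) * u k i))"
    by (subst sum.swap) (simp add: sum_distrib_left)
  also have "\<dots> = (\<Sum>k<N. complex_of_real (eig k))"
    by (intro sum.cong refl) (simp add: spectral_decompositionD1[OF assms])
  finally show ?thesis by simp
qed

text \<open>The eigenvalue is the expectation in its unit eigenvector, a sum of N^2 terms of modulus
  at most \<open>B\<close>. It is applied with N = d^r, which does not grow with the chain, so the
  crude factor only affects constants.\<close>

lemma spectral_decomposition_bound:
  assumes sd: "spectral_decomposition N h u eig" and k: "k < N"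
    and h: "\<And>i j. i < N \<Longrightarrow> j < N \<Longrightarrow> cmod (h i j) \<le> B"
  shows "\<bar>eig k\<bar> \<le> (real N)\<^sup>2 * B"
proof -
  note ob = spectral_decomposition_basis[OF sd]
  have u1: "cmod (u k i) \<le> 1" if "i < N" for i
  proof -
    have "(cmod (u k i))\<^sup>2 \<le> (\<Sum>i<N. (cmod (u k i))\<^sup>2)"
      by (rule member_le_sum) (use that in auto)
    thus ?thesis by (simp add: sum_cmod_square_basis[OF ob k] abs_square_le_1)
  qed
  have "complex_of_real (eig k) = (\<Sum>i<N. cnj (u k i) * (eig k * u k i))"
    using orthonormal_basisD1[OF ob k k] by (simp add: mult.left_commute flip: sum_distrib_left)
  also have "\<dots> = (\<Sum>i<N. \<Sum>j<N. cnj (u k i) * (h i j * u k j))"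
    unfolding sum_distrib_left[symmetric]
    by (intro sum.cong refl) (simp add: spectral_decomposition_eigenvector[OF sd k])
  finally have "\<bar>eig k\<bar> = cmod (\<Sum>i<N. \<Sum>j<N. cnj (u k i) * (h i j * u k j))"
    by (metis norm_of_real)
  also have "\<dots> \<le> (\<Sum>i<N. \<Sum>j<N. B)"
  proof (intro sum_norm_le)
    fix i j assume ij: "i \<in> {..<N}" "j \<in> {..<N}"
    have "cmod (u k i) * (cmod (h i j) * cmod (u k j)) \<le> 1 * (B * 1)"
      using ij u1 h order_trans[OF norm_ge_zero h[of i j]] by (intro mult_mono) auto
    thus "cmod (cnj (u k i) * (h i j * u k j)) \<le> B" by (simp add: norm_mult)
  qed
  finally show ?thesis by (simp add: power2_eq_square mult.assoc)
qed

text \<open>The trace of an operator on block 0 tensored with the identity: each configuration of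
  the block occurs d^(n - r) times.\<close>

lemma sum_blocks_diagonal:
  fixes f :: "nat \<Rightarrow> complex"
  assumes d: "d > 0" and r: "0 < r" "r \<le> n"
  shows "(\<Sum>i<d ^ n. f (blocks d n r i 0)) = (\<Sum>P<d ^ r. f P) * d ^ (n - r)"
proof -
  let ?w = "block_width n r"
  have m: "0 < n div r" using r by (simp add: div_greater_zero_iff)
  have "(\<Sum>i<d ^ n. f (blocks d n r i 0))
      = (\<Sum>i<d ^ n. \<Prod>j\<le>n div r. if j = 0 then f (blocks d n r i j) else 1)"
    by (intro sum.cong refl) simp
  also have "\<dots> = (\<Prod>j\<le>n div r. \<Sum>a<d ^ ?w j. if j = 0 then f a else 1)"
    by (rule sum_prod_reindex[OF _ _ bij_betw_blocks[OF d r(1)]]) simp_all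
  also have "\<dots> = (\<Sum>a<d ^ ?w 0. f a) * (\<Prod>j\<in>{..n div r} - {0}. of_nat (d ^ ?w j))"
    by (subst prod.remove[of _ 0]) (auto intro!: prod.cong)
  also have "?w 0 = r" using m by (simp add: block_width_def)
  also have "(\<Prod>j\<in>{..n div r} - {0}. of_nat (d ^ ?w j)) = (of_nat d ^ (\<Sum>j\<in>{..n div r} - {0}. ?w j) :: complex)"
    by (simp add: power_sum)
  also have "(\<Sum>j\<in>{..n div r} - {0}. ?w j) = n - r"
  proof -
    have "(\<Sum>j\<le>n div r. ?w j) = (\<Sum>j<n div r. ?w j) + ?w (n div r)"
      by (simp add: lessThan_Suc_atMost[symmetric])
    also have "\<dots> = n" by (simp add: block_width_def)
    finally have "?w 0 + (\<Sum>j\<in>{..n div r} - {0}. ?w j) = n" by (subst (asm) sum.remove[of _ 0]) auto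
    thus ?thesis using m by (simp add: block_width_def)
  qed
  finally show ?thesis by simp
qed

text \<open>For m = \<open>n div r\<close> the left side is d^n times the exponential moment of a_k
  under uniform \<open>k\<close>. Each full block contributes d^r exp ((x / m)^2 B^2) with B =
  d^(2r) M, and the remainder contributes its dimension; the dimensions multiply to d^n and the m
  exponents add up to x^2 B^2 / m.\<close>

lemma sum_exp_diagonal_le:
  fixes A H :: "complex mat" and x :: real and c :: complex
  assumes d: "d > 0" and r: "0 < r" "r \<le> n"
    and H: "H \<in> carrier_mat (d ^ n) (d ^ n)" and comm: "H * transl d n = transl d n * H"
    and sd: "spectral_decomposition (d ^ n) (\<lambda>i j. H $$ (i, j)) u eig" and inj: "inj_on eig {..<d ^ n}"
    and A: "A \<in> carrier_mat (d ^ n) (d ^ n)" and tr: "mat_trace A = 0" and loc: "r_local d n r A"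
    and M: "op_norm A \<le> M" and c: "cmod c = 1"
  shows "(\<Sum>k<d ^ n. exp (x * Re (c * quad_form (d ^ n) (u k) (\<lambda>i j. A $$ (i, j)))))
    \<le> d ^ n * exp (x\<^sup>2 * (real d ^ (2 * r) * M)\<^sup>2 / real (n div r))"
proof -
  let ?N = "d ^ n" and ?m = "n div r" and ?w = "block_width n r"
  have m: "0 < ?m" using r by (simp add: div_greater_zero_iff)
  have w0: "?w j = r" if "j < ?m" for j using that by (simp add: block_width_def)
  note ob = spectral_decomposition_basis[OF sd]
  obtain \<tau> where \<tau>: "is_rotation d n \<tau>" using ex_rotation[OF d] by blast
  hence \<tau>b: "bij_betw \<tau> {..<?N} {..<?N}" by (simp add: is_rotation_def)
  from loc obtain s b where s: "s < n" and b: "\<forall>i<d ^ n. \<forall>j<d ^ n. A $$ (i, j) =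
        (if (\<forall>l<n. l \<notin> {(s + k) mod n | k. k < r} \<longrightarrow> digit d n i l = digit d n j l)
         then b (restrict (\<lambda>k. digit d n i ((s + k) mod n)) {..<r})
                (restrict (\<lambda>k. digit d n j ((s + k) mod n)) {..<r})
         else 0)"
    unfolding r_local_def by blast
  define b' where "b' = local_coeff d r b"
  \<comment> \<open>The number of rotations that carries the support of \<open>A\<close> from
    \<open>s\<close> to the start of block \<open>j\<close>; \<open>g j\<close> below is the
    resulting copy.\<close>
  define p where "p = (\<lambda>j. n + r * j - s)"
  define g where "g = (\<lambda>j i i'. if \<forall>l\<in>{..?m} - {j}. blocks d n r i l = blocks d n r i' l
      then b' (blocks d n r i j) (blocks d n r i' j) else 0)"
  have Ag: "A $$ ((\<tau> ^^ p j) i, (\<tau> ^^ p j) i') = g j i i'" if "j < ?m" "i < ?N" "i' < ?N" for i i' j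
  proof -
    have "r * j + r \<le> n" using block_end[of j n r] that by (simp add: w0)
    from local_rotated[OF \<tau> s this b that(2,3)] that(1) show ?thesis
      by (simp only: agree_off_block_iff[OF d r(1) that(1)] g_def p_def b'_def)
        (simp add: blocks_def w0)
  qed
  have diag: "quad_form ?N (u k) (\<lambda>i j. A $$ (i, j)) = quad_form ?N (u k) (g j)" if kj: "k < ?N" "j < ?m" for k j
  proof -
    have inv: "\<forall>i<?N. \<forall>j<?N. H $$ (\<tau> i, \<tau> j) = H $$ (i, j)"
      using commuting_rotation_invariant[OF H comm \<tau>] by blast
    obtain \<mu> where "cmod \<mu> = 1" "\<forall>i<?N. u k (\<tau> i) = \<mu> * u k i"
      using eigenvector_of_commuting_permutation[OF sd inj \<tau>b inv kj(1)] by blast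
    from quad_form_permute_funpow[OF \<tau>b this, of "\<lambda>i j. A $$ (i, j)" "p j"]
    show ?thesis by (simp add: Ag kj cong: quad_form_cong)
  qed
  have tau_lt: "(\<tau> ^^ q) i < ?N" if "i < ?N" for i q by (rule rotation_funpow_less[OF \<tau> that])

  \<comment> \<open>The trace of \<open>A\<close> is d^(n - r) times that of the coefficient matrix,
    so the latter is traceless too. This is what centres its eigenvalues.\<close>
  have b'_trace: "(\<Sum>P<d ^ r. b' P P) = 0"
  proof -
    have "bij_betw (\<tau> ^^ p 0) {..<?N} {..<?N}" by (rule bij_betw_funpow[OF \<tau>b])
    hence "(\<Sum>i<?N. A $$ ((\<tau> ^^ p 0) i, (\<tau> ^^ p 0) i)) = (\<Sum>i<?N. A $$ (i, i))"
      by (rule sum.reindex_bij_betw)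
    also have "\<dots> = 0" using tr A by (simp add: mat_trace_def)
    finally have "(\<Sum>i<?N. b' (blocks d n r i 0) (blocks d n r i 0)) = 0"
      using m by (simp add: Ag g_def)
    thus ?thesis using sum_blocks_diagonal[OF d r, of "\<lambda>P. b' P P"] d by simp
  qed
  \<comment> \<open>Each entry of \<open>b'\<close> is an entry of the rotated \<open>A\<close>, at
    configurations equal to \<open>P\<close> and \<open>Q\<close> on block 0 and zero on all other
    blocks.\<close>
  have b'_le: "cmod (b' P Q) \<le> M" if PQ: "P < d ^ r" "Q < d ^ r" for P Q
  proof -
    have "\<exists>i<?N. \<forall>j\<le>?m. blocks d n r i j = (if j = 0 then R else 0)" if "R < d ^ r" for R
    proof -
      let ?f = "restrict (\<lambda>j. if j = 0 then R else 0) {..?m}"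
      have "?f \<in> PiE {..?m} (\<lambda>j. {..<d ^ ?w j})"
        using that m d by (auto simp: w0)
      hence "?f \<in> blocks d n r ` {..<?N}"
        using bij_betw_imp_surj_on[OF bij_betw_blocks[OF d r(1), of n]] by (simp only:)
      then obtain i where "i < ?N" "blocks d n r i = ?f" by auto
      thus ?thesis by (intro exI[of _ i]) simp
    qed
    then obtain i i' where i: "i < ?N" "\<forall>j\<le>?m. blocks d n r i j = (if j = 0 then P else 0)"
      and i': "i' < ?N" "\<forall>j\<le>?m. blocks d n r i' j = (if j = 0 then Q else 0)"
      using PQ by meson
    have "b' P Q = A $$ ((\<tau> ^^ p 0) i, (\<tau> ^^ p 0) i')"
      using Ag[OF m i(1) i'(1)] i(2) i'(2) by (simp add: g_def)
    also have "cmod \<dots> \<le> op_norm A"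
      by (rule cmod_entry_le_op_norm[OF A tau_lt[OF i(1)] tau_lt[OF i'(1)]])
    finally show ?thesis using M by simp
  qed

  \<comment> \<open>The Hermitian part of \<open>c\<close> times the coefficient matrix. It is the
    same for all blocks, so one eigenbasis serves every copy.\<close>
  define h where "h = (\<lambda>P Q. (c * b' P Q + cnj (c * b' Q P)) / 2)"
  obtain w e where he: "spectral_decomposition (d ^ r) h w e"
    by (rule hermitian_spectral_theorem[of "d ^ r" h]) (auto simp: h_def)
  have "complex_of_real (\<Sum>a<d ^ r. e a) = (\<Sum>P<d ^ r. h P P)"
    by (rule spectral_decomposition_trace[OF he, symmetric])
  also have "\<dots> = (c * (\<Sum>P<d ^ r. b' P P) + cnj (c * (\<Sum>P<d ^ r. b' P P))) / 2"
    by (simp add: h_def sum_distrib_left sum.distrib flip: sum_divide_distrib)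
  finally have e0: "(\<Sum>a<d ^ r. e a) = 0" by (simp add: b'_trace del: of_real_sum)
  have eM: "\<bar>e a\<bar> \<le> real d ^ (2 * r) * M" if "a < d ^ r" for a
  proof -
    have "cmod (h P Q) \<le> M" if "P < d ^ r" "Q < d ^ r" for P Q
      using norm_triangle_ineq[of "c * b' P Q" "cnj (c * b' Q P)"] b'_le[OF that] b'_le[OF that(2,1)]
      by (simp add: h_def norm_divide norm_mult c)
    from spectral_decomposition_bound[OF he that this] show ?thesis
      by (simp add: power_mult[symmetric] mult.commute[of 2])
  qed

  define W where "W = (\<lambda>j. if j < ?m then w else (\<lambda>a p. if a = p then 1 else 0))"
  \<comment> \<open>The factor x / m arises because \<open>x * Re (c * a_k)\<close> is split evenly
    over the m copies; the remainder gets weight 0.\<close>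
  define \<beta> where "\<beta> = (\<lambda>j a. if j < ?m then x / ?m * e a else 0)"
  define X where "X = (\<lambda>j i i'. if \<forall>l\<in>{..?m} - {j}. blocks d n r i l = blocks d n r i' l
      then \<Sum>a<d ^ ?w j. \<beta> j a * (W j a (blocks d n r i j) * cnj (W j a (blocks d n r i' j))) else 0)"
  have W: "orthonormal_basis (d ^ ?w j) (W j)" if "j \<in> {..?m}" for j
    using spectral_decomposition_basis[OF he] orthonormal_basis_standard
    by (cases "j < ?m") (simp_all add: W_def w0)
  have X: "X j i i' = of_real (x / ?m) * ((c * g j i i' + cnj (c * g j i' i)) / 2)"
    if "j < ?m" "i < ?N" "i' < ?N" for j i i'
  proof -
    have lt: "blocks d n r i j < d ^ r" "blocks d n r i' j < d ^ r"
      using that d by (simp_all add: blocks_def w0 window_less)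
    have "(\<Sum>a<d ^ ?w j. \<beta> j a * (W j a (blocks d n r i j) * cnj (W j a (blocks d n r i' j))))
        = of_real (x / ?m) * h (blocks d n r i j) (blocks d n r i' j)"
      using that lt by (simp add: \<beta>_def W_def w0 spectral_decompositionD3[OF he] sum_distrib_left mult.assoc)
    moreover have "(\<forall>l\<in>{..?m} - {j}. blocks d n r i' l = blocks d n r i l)
        \<longleftrightarrow> (\<forall>l\<in>{..?m} - {j}. blocks d n r i l = blocks d n r i' l)"
      by (intro ball_cong refl eq_commute)
    ultimately show ?thesis by (simp only: X_def g_def h_def) simp
  qed
  have ReX: "Re (quad_form ?N (u k) (X j)) = x / ?m * Re (c * quad_form ?N (u k) (\<lambda>i j. A $$ (i, j)))"
    if "j < ?m" "k < ?N" for j k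
  proof -
    have "quad_form ?N (u k) (X j) = quad_form ?N (u k) (\<lambda>i i'. of_real (x / ?m) * ((c * g j i i' + cnj (c * g j i' i)) / 2))"
      by (intro quad_form_cong X that)
    also have "\<dots> = of_real (x / ?m) * quad_form ?N (u k) (\<lambda>i i'. (c * g j i i' + cnj (c * g j i' i)) / 2)"
      unfolding quad_form_def sum_distrib_left by (intro sum.cong refl) (simp only: mult_ac)
    finally have "Re (quad_form ?N (u k) (X j))
        = x / ?m * Re (quad_form ?N (u k) (\<lambda>i i'. (c * g j i i' + cnj (c * g j i' i)) / 2))"
      by simp
    thus ?thesis
      by (simp only: Re_quad_form_hermitian_part diag[OF that(2,1)])
  qed
  \<comment> \<open>Collects the local dimensions: r m' + l becomes n for m' =
    \<open>n div r\<close> and l = \<open>n mod r\<close>.\<close>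
  have pow: "(\<Prod>j<m'. real (d ^ r) * exp y) * real (d ^ l) = real (d ^ (r * m' + l)) * exp (m' * y)" for m' l y
    by (simp add: power_add power_mult power_mult_distrib exp_of_nat_mult)
  have "X ?m = (\<lambda>i i'. 0)" by (intro ext) (simp add: X_def \<beta>_def)
  hence "(\<Sum>j\<le>?m. Re (quad_form ?N (u k) (X j))) = (\<Sum>j<?m. Re (quad_form ?N (u k) (X j)))" for k
    by (simp add: lessThan_Suc_atMost[symmetric] quad_form_def)
  hence "(\<Sum>j\<le>?m. Re (quad_form ?N (u k) (X j))) = x * Re (c * quad_form ?N (u k) (\<lambda>i j. A $$ (i, j)))"
    if "k < ?N" for k using that m by (simp add: ReX)
  hence "(\<Sum>k<?N. exp (x * Re (c * quad_form ?N (u k) (\<lambda>i j. A $$ (i, j)))))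
      = (\<Sum>k<?N. exp (\<Sum>j\<le>?m. Re (quad_form ?N (u k) (X j))))"
    by (intro sum.cong refl) simp
  also have "\<dots> \<le> (\<Prod>j\<le>?m. \<Sum>a<d ^ ?w j. exp (\<beta> j a))"
    unfolding quad_form_def X_def
    by (rule sum_exp_product_basis[OF _ bij_betw_blocks[OF d r(1)] W ob]) simp_all
  also have "\<dots> = (\<Prod>j<?m. \<Sum>a<d ^ r. exp (x / ?m * e a)) * real (d ^ (n mod r))"
    by (simp add: lessThan_Suc_atMost[symmetric] \<beta>_def w0) (simp add: block_width_def)
  also have "\<dots> \<le> (\<Prod>j<?m. real (d ^ r) * exp ((x / ?m)\<^sup>2 * (real d ^ (2 * r) * M)\<^sup>2)) * real (d ^ (n mod r))"
    by (intro mult_right_mono prod_mono conjI sum_nonneg sum_exp_le_centered[OF e0 eM]) auto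
  also have "\<dots> = real (d ^ (r * ?m + n mod r)) * exp (?m * ((x / ?m)\<^sup>2 * (real d ^ (2 * r) * M)\<^sup>2))"
    by (rule pow)
  also have "r * ?m + n mod r = n" by simp
  also have "?m * ((x / ?m)\<^sup>2 * (real d ^ (2 * r) * M)\<^sup>2) = x\<^sup>2 * (real d ^ (2 * r) * M)\<^sup>2 / ?m"
    using m by (simp add: power2_eq_square)
  finally show ?thesis by simp
qed

section \<open>Moments of the Haar measure on one site\<close>

lemma sets_cgauss [measurable_cong]: "sets cgauss = sets borel"
  by (simp add: cgauss_def)

lemma space_cgauss [simp]: "space cgauss = UNIV"
  by (simp add: cgauss_def)

text \<open>The density factors into two real normal densities of standard deviation 1 / sqrt 2, one
  for each of the real and imaginary parts.\<close>

lemma prob_space_cgauss: "prob_space cgauss"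
proof
  define f :: "real \<Rightarrow> real" where "f = normal_density 0 (1 / sqrt 2)"
  have f: "f x = exp (- x\<^sup>2) / sqrt pi" for x
    by (simp add: f_def normal_density_def real_sqrt_mult power_divide)
  have "(\<integral>\<^sup>+x. f x \<partial>lborel) = 1"
    unfolding f_def by (subst nn_integral_eq_integral) auto
  moreover have "ennreal (exp (- (cmod z)\<^sup>2) / pi) = (\<Prod>b\<in>Basis. ennreal (f (z \<bullet> b)))" for z
    by (simp add: Basis_complex_def f cmod_power2 ennreal_mult[symmetric] exp_add exp_diff exp_minus field_simps
        flip: real_sqrt_mult)
  ultimately have "(\<integral>\<^sup>+z. ennreal (exp (- (cmod z)\<^sup>2) / pi) \<partial>lborel) = 1"
    using nn_integral_lborel_prod[of "\<lambda>b::complex. \<lambda>x. ennreal (f x)"]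
    by (simp add: f_def)
  thus "emeasure cgauss (space cgauss) = 1"
    by (simp add: cgauss_def emeasure_density)
qed

lemma lborel_distr_uminus_complex: "distr lborel borel uminus = (lborel :: complex measure)"
proof -
  have "density (distr lborel borel uminus) (\<lambda>_. 1) = (lborel :: complex measure)"
    using lborel_affine[of "-1" "0 :: complex"] by simp
  thus ?thesis by (simp add: density_1)
qed

text \<open>The Gaussian weight depends on the modulus only and Lebesgue measure is invariant under
  z -> -z, so the integral equals its own negative.\<close>

lemma integral_cgauss_odd:
  fixes f :: "complex \<Rightarrow> complex"
  assumes [measurable]: "f \<in> borel_measurable borel" and odd: "\<And>z. f (- z) = - f z"
  shows "(\<integral>z. f z \<partial>cgauss) = 0"
proof -
  define g where "g = (\<lambda>z. (exp (- (cmod z)\<^sup>2) / pi) *\<^sub>R f z)"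
  have [measurable]: "g \<in> borel_measurable borel" by (simp add: g_def)
  have int: "(\<integral>z. f z \<partial>cgauss) = (\<integral>z. g z \<partial>lborel)"
    unfolding cgauss_def g_def by (subst integral_density) auto
  have "(\<integral>z. g z \<partial>lborel) = (\<integral>z. g z \<partial>distr lborel borel uminus)"
    by (simp only: lborel_distr_uminus_complex)
  also have "\<dots> = (\<integral>z. g (- z) \<partial>lborel)" by (subst integral_distr) auto
  also have "\<dots> = - (\<integral>z. g z \<partial>lborel)" by (simp add: g_def odd)
  finally show ?thesis by (simp add: int)
qed

definition gauss_vec :: "nat \<Rightarrow> (nat \<Rightarrow> complex) measure" where
  "gauss_vec d = PiM {..<d} (\<lambda>_. cgauss)"

definition sq_norm :: "nat \<Rightarrow> (nat \<Rightarrow> complex) \<Rightarrow> real" where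
  "sq_norm d g = (\<Sum>k<d. (cmod (g k))\<^sup>2)"

lemma sq_norm_nonneg: "sq_norm d g \<ge> 0"
  by (simp add: sq_norm_def sum_nonneg)

lemma cmod_le_sq_norm: "x < d \<Longrightarrow> (cmod (g x))\<^sup>2 \<le> sq_norm d g"
  unfolding sq_norm_def by (rule member_le_sum) auto

lemma prob_space_gauss_vec: "prob_space (gauss_vec d)"
  unfolding gauss_vec_def by (intro prob_space_PiM prob_space_cgauss)

lemma sets_gauss_vec [measurable_cong]: "sets (gauss_vec d) = sets (PiM {..<d} (\<lambda>_. borel))"
  unfolding gauss_vec_def by (intro sets_PiM_cong refl sets_cgauss)

lemma measurable_gauss_component [measurable]:
  "x < d \<Longrightarrow> (\<lambda>g. g x) \<in> borel_measurable (gauss_vec d)"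
  unfolding gauss_vec_def using measurable_component_singleton[of x "{..<d}" "\<lambda>_. cgauss"]
  by (simp add: measurable_cong_sets[OF refl sets_cgauss])

lemma measurable_sq_norm [measurable]: "sq_norm d \<in> borel_measurable (gauss_vec d)"
  unfolding sq_norm_def [abs_def] by measurable

definition normalize :: "nat \<Rightarrow> (nat \<Rightarrow> complex) \<Rightarrow> nat \<Rightarrow> complex" where
  "normalize d g = restrict (\<lambda>j. g j / of_real (sqrt (sq_norm d g))) {..<d}"

lemma haar_site_eq: "haar_site d = distr (gauss_vec d) (PiM {..<d} (\<lambda>_. borel)) (normalize d)"
  by (simp add: haar_site_def gauss_vec_def normalize_def[abs_def] sq_norm_def)

lemma measurable_normalize [measurable]:
  "normalize d \<in> gauss_vec d \<rightarrow>\<^sub>M PiM {..<d} (\<lambda>_. borel)"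
  unfolding normalize_def[abs_def] by (intro measurable_restrict) simp

lemma prob_space_haar_site: "prob_space (haar_site d)"
  unfolding haar_site_eq by (intro prob_space.prob_space_distr prob_space_gauss_vec measurable_normalize)

lemma sets_haar_site [measurable_cong]: "sets (haar_site d) = sets (PiM {..<d} (\<lambda>_. borel))"
  by (simp add: haar_site_eq)

lemma measurable_borel_component [measurable]:
  "x < d \<Longrightarrow> (\<lambda>\<phi>. \<phi> x) \<in> borel_measurable (PiM {..<d} (\<lambda>_. borel))"
  by (intro measurable_component_singleton) simp

lemma measurable_haar_component [measurable]:
  "x < d \<Longrightarrow> (\<lambda>\<phi>. \<phi> x) \<in> borel_measurable (haar_site d)"
  by (simp add: measurable_cong_sets[OF sets_haar_site refl])

lemma measurable_cnj [measurable]: "cnj \<in> borel_measurable borel"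
  by (intro borel_measurable_continuous_onI continuous_intros)

lemma measurable_borel_product:
  assumes "x < d" "y < d"
  shows "(\<lambda>\<phi>. \<phi> x * cnj (\<phi> y)) \<in> borel_measurable (PiM {..<d} (\<lambda>_. borel))"
proof -
  note [measurable] = measurable_borel_component[OF assms(1)] measurable_borel_component[OF assms(2)]
  show ?thesis by measurable
qed

text \<open>An inequality because the zero vector is normalised to zero, division by 0 being 0;
  every other vector gets norm 1.\<close>

lemma normalize_sq_norm_le: "(\<Sum>x<d. (cmod (normalize d g x))\<^sup>2) \<le> 1"
proof -
  have "(\<Sum>x<d. (cmod (normalize d g x))\<^sup>2) = (\<Sum>x<d. (cmod (g x))\<^sup>2 / sq_norm d g)"
    by (intro sum.cong refl)
      (simp add: normalize_def norm_divide power_divide sq_norm_nonneg)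
  also have "\<dots> = sq_norm d g / sq_norm d g" by (simp add: sq_norm_def flip: sum_divide_distrib)
  finally show ?thesis by simp
qed

lemma AE_haar_site_norm: "AE \<phi> in haar_site d. (\<Sum>x<d. (cmod (\<phi> x))\<^sup>2) \<le> 1"
proof -
  have "{\<phi> \<in> space (PiM {..<d} (\<lambda>_. borel)). (\<Sum>x<d. (cmod (\<phi> x))\<^sup>2) \<le> 1} \<in> sets (PiM {..<d} (\<lambda>_. borel :: complex measure))"
    by measurable
  thus ?thesis
    unfolding haar_site_eq by (subst AE_distr_iff) (auto intro: normalize_sq_norm_le)
qed

lemma integrable_haar_product:
  assumes xy: "x < d" "y < d"
  shows "integrable (haar_site d) (\<lambda>\<phi>. \<phi> x * cnj (\<phi> y))"
proof -
  interpret prob_space "haar_site d" by (rule prob_space_haar_site)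
  show ?thesis
  proof (rule integrable_const_bound[where B = 1])
    show "AE \<phi> in haar_site d. norm (\<phi> x * cnj (\<phi> y)) \<le> 1"
      using AE_haar_site_norm
    proof eventually_elim
      case (elim \<phi>)
      have "cmod (\<phi> z) \<le> 1" if "z < d" for z
        using order_trans[OF cmod_le_sq_norm[OF that, of \<phi>] elim[folded sq_norm_def]]
        by (simp add: abs_square_le_1)
      thus ?case using xy by (simp add: norm_mult mult_le_one)
    qed
  qed (simp add: measurable_cong_sets[OF sets_haar_site refl] measurable_borel_product xy)
qed

text \<open>Integrate over coordinate \<open>x\<close> alone: flipping its sign preserves the norm,
  hence the normalisation, but negates the product, so the inner integral vanishes.\<close>

lemma haar_off_diagonal:
  assumes xy: "x < d" "y < d" "x \<noteq> y"
  shows "(\<integral>\<phi>. \<phi> x * cnj (\<phi> y) \<partial>haar_site d) = 0"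
proof -
  interpret product_sigma_finite "\<lambda>_::nat. cgauss"
    by unfold_locales (rule prob_space_imp_sigma_finite[OF prob_space_cgauss, THEN sigma_finite_measure.sigma_finite_countable])
  define F where "F = (\<lambda>g. normalize d g x * cnj (normalize d g y))"
  have "integrable (gauss_vec d) F"
    using integrable_haar_product[OF xy(1,2)] xy unfolding haar_site_eq F_def
    by (subst (asm) integrable_distr_eq) (simp_all add: measurable_borel_product)
  hence int: "integrable (PiM (insert x ({..<d} - {x})) (\<lambda>_. cgauss)) F"
    using xy by (simp add: gauss_vec_def insert_absorb)
  have "(\<integral>\<phi>. \<phi> x * cnj (\<phi> y) \<partial>haar_site d) = (\<integral>g. F g \<partial>gauss_vec d)"
    unfolding haar_site_eq F_def
    by (subst integral_distr) (use xy in \<open>simp_all add: measurable_borel_product\<close>)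
  also have "\<dots> = (\<integral>g. F g \<partial>PiM (insert x ({..<d} - {x})) (\<lambda>_. cgauss))"
    using xy by (simp add: gauss_vec_def insert_absorb)
  also have "\<dots> = (\<integral>h. (\<integral>z. F (h(x := z)) \<partial>cgauss) \<partial>PiM ({..<d} - {x}) (\<lambda>_. cgauss))"
    by (rule product_integral_insert[OF _ _ int]) auto
  also have "\<dots> = (\<integral>h. 0 \<partial>PiM ({..<d} - {x}) (\<lambda>_. cgauss))"
  proof (intro Bochner_Integration.integral_cong refl integral_cgauss_odd)
    fix h :: "nat \<Rightarrow> complex"
    have sq: "sq_norm d (h(x := z)) = (cmod z)\<^sup>2 + (\<Sum>k\<in>{..<d} - {x}. (cmod (h k))\<^sup>2)" for z
      unfolding sq_norm_def using xy by (subst sum.remove[of _ x]) auto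
    show "(\<lambda>z. F (h(x := z))) \<in> borel_measurable borel"
      using xy unfolding F_def normalize_def sq by simp
    show "F (h(x := - z)) = - F (h(x := z))" for z
      using xy by (simp add: F_def normalize_def sq)
  qed
  finally show ?thesis by simp
qed

text \<open>The coordinates are exchangeable, so their \<open>d\<close> second moments coincide, and
  these sum to at most 1.\<close>

lemma haar_diagonal:
  assumes x: "x < d"
  shows "(\<integral>\<phi>. (cmod (\<phi> x))\<^sup>2 \<partial>haar_site d) \<le> 1 / d"
proof -
  interpret H: prob_space "haar_site d" by (rule prob_space_haar_site)
  have int: "integrable (haar_site d) (\<lambda>\<phi>. (cmod (\<phi> y))\<^sup>2)" if y: "y < d" for y
  proof (rule H.integrable_const_bound[where B = 1])
    show "AE \<phi> in haar_site d. norm ((cmod (\<phi> y))\<^sup>2) \<le> 1"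
      using AE_haar_site_norm
    proof eventually_elim
      case (elim \<phi>)
      thus ?case using order_trans[OF cmod_le_sq_norm[OF y, of \<phi>] elim[folded sq_norm_def]] by simp
    qed
  qed (use y in measurable)
  have eq: "(\<integral>\<phi>. (cmod (\<phi> y))\<^sup>2 \<partial>haar_site d) = (\<integral>\<phi>. (cmod (\<phi> x))\<^sup>2 \<partial>haar_site d)" if y: "y < d" for y
  proof -
    \<comment> \<open>Swaps coordinates \<open>x\<close> and \<open>y\<close>. The product Gaussian
      and the norm are both invariant, and \<open>normalize\<close> at \<open>y\<close> becomes
      \<open>normalize\<close> at \<open>x\<close>.\<close>
    define t where "t = (\<lambda>\<omega> :: nat \<Rightarrow> complex. \<lambda>k\<in>{..<d}. \<omega> (Transposition.transpose x y k))"
    have bij: "bij_betw (Transposition.transpose x y) {..<d} {..<d}"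
      using x y by (intro bij_betw_byWitness[where f' = "Transposition.transpose x y"]) (auto simp: Transposition.transpose_def)
    have tm: "t \<in> gauss_vec d \<rightarrow>\<^sub>M gauss_vec d"
      unfolding t_def gauss_vec_def
      using x y by (intro measurable_restrict measurable_component_singleton) (auto simp: Transposition.transpose_def)
    have dt: "distr (gauss_vec d) (gauss_vec d) t = gauss_vec d"
      unfolding t_def gauss_vec_def
      using distr_PiM_reindex[of "{..<d}" "\<lambda>_. cgauss" "Transposition.transpose x y" "{..<d}"] prob_space_cgauss bij
        bij_betw_imp_funcset[OF bij]
      by (simp add: bij_betw_def)
    have sq: "sq_norm d (t g) = sq_norm d g" for g
      using sum.reindex_bij_betw[OF bij, of "\<lambda>k. (cmod (g k))\<^sup>2"] by (simp add: sq_norm_def t_def)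
    have "(\<integral>\<phi>. (cmod (\<phi> z))\<^sup>2 \<partial>haar_site d) = (\<integral>g. (cmod (normalize d g z))\<^sup>2 \<partial>gauss_vec d)" if "z < d" for z
      unfolding haar_site_eq by (subst integral_distr) (use that in auto)
    moreover have "(\<integral>g. (cmod (normalize d g y))\<^sup>2 \<partial>gauss_vec d) = (\<integral>g. (cmod (normalize d (t g) y))\<^sup>2 \<partial>gauss_vec d)"
      by (subst dt[symmetric], subst integral_distr[OF tm]) (use y in auto)
    moreover have "normalize d (t g) y = normalize d g x" for g
      using x y by (simp add: normalize_def sq) (simp add: t_def)
    ultimately show ?thesis using x y by simp
  qed
  have "d * (\<integral>\<phi>. (cmod (\<phi> x))\<^sup>2 \<partial>haar_site d) = (\<Sum>y<d. \<integral>\<phi>. (cmod (\<phi> y))\<^sup>2 \<partial>haar_site d)"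
    by (simp add: eq)
  also have "\<dots> = (\<integral>\<phi>. (\<Sum>y<d. (cmod (\<phi> y))\<^sup>2) \<partial>haar_site d)"
    by (rule Bochner_Integration.integral_sum[symmetric]) (use int in auto)
  also have "\<dots> \<le> (\<integral>\<phi>. 1 \<partial>haar_site d)"
    by (intro integral_mono_AE AE_haar_site_norm Bochner_Integration.integrable_sum) (use int in auto)
  also have "\<dots> = 1" by (simp add: H.prob_space)
  finally show ?thesis using x by (simp add: field_simps)
qed

section \<open>Random product states\<close>

lemma bij_betw_digits:
  assumes "d > 0"
  shows "bij_betw (\<lambda>i. restrict (digit d n i) {..<n}) {..<d ^ n} (PiE {..<n} (\<lambda>_. {..<d}))"
proof -
  let ?f = "\<lambda>i. restrict (digit d n i) {..<n}"
  have inj: "inj_on ?f {..<d ^ n}"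
  proof (rule inj_onI)
    fix i j assume *: "i \<in> {..<d ^ n}" "j \<in> {..<d ^ n}" "?f i = ?f j"
    show "i = j"
    proof (rule digit_inject[of _ d n])
      show "digit d n i l = digit d n j l" if "l < n" for l
        using fun_cong[OF *(3), of l] that by simp
    qed (use * in auto)
  qed
  have sub: "?f ` {..<d ^ n} \<subseteq> PiE {..<n} (\<lambda>_. {..<d})"
    by (intro image_subsetI PiE_I) (simp_all add: digit_less assms)
  have "card (?f ` {..<d ^ n}) = card (PiE {..<n} (\<lambda>_. {..<d}))"
    using card_image[OF inj] by (simp add: card_PiE)
  hence "?f ` {..<d ^ n} = PiE {..<n} (\<lambda>_. {..<d})"
    by (intro card_subset_eq sub finite_PiE) auto
  thus ?thesis using inj by (simp add: bij_betw_def)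
qed

lemma sum_prod_digits:
  fixes f :: "nat \<Rightarrow> nat \<Rightarrow> 'c :: comm_semiring_1"
  assumes "d > 0"
  shows "(\<Sum>i<d ^ n. \<Prod>l<n. f l (digit d n i l)) = (\<Prod>l<n. \<Sum>x<d. f l x)"
  using sum_prod_reindex[OF _ _ bij_betw_digits[OF assms], of n f] by simp

text \<open>Parseval's identity, obtained from completeness of the basis.\<close>

lemma sum_overlaps:
  assumes "orthonormal_basis N u"
  shows "(\<Sum>k<N. (cmod (\<Sum>i<N. cnj (u k i) * v i))\<^sup>2) = (\<Sum>i<N. (cmod (v i))\<^sup>2)"
proof -
  have "complex_of_real (\<Sum>k<N. (cmod (\<Sum>i<N. cnj (u k i) * v i))\<^sup>2 * 1)
      = (\<Sum>i<N. \<Sum>j<N. cnj (v i) * (\<Sum>k<N. complex_of_real 1 * u k i * cnj (u k j)) * v j)"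
    by (rule weighted_overlap)
  also have "\<dots> = (\<Sum>i<N. \<Sum>j<N. if j = i then complex_of_real ((cmod (v i))\<^sup>2) else 0)"
  proof (intro sum.cong refl)
    fix i j assume ij: "i \<in> {..<N}" "j \<in> {..<N}"
    have "(\<Sum>k<N. complex_of_real 1 * u k i * cnj (u k j)) = (if j = i then 1 else 0)"
      using orthonormal_basisD2[OF assms, of i j] ij by auto
    thus "cnj (v i) * (\<Sum>k<N. complex_of_real 1 * u k i * cnj (u k j)) * v j
        = (if j = i then complex_of_real ((cmod (v i))\<^sup>2) else 0)"
      by (simp only: complex_norm_square) (simp add: mult.commute)
  qed
  also have "\<dots> = complex_of_real (\<Sum>i<N. (cmod (v i))\<^sup>2)" by simp
  finally show ?thesis by (simp only: of_real_eq_iff mult_1_right)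
qed

lemma prob_space_prod_measure: "prob_space (prod_measure d n)"
  unfolding prod_measure_def by (intro prob_space_PiM prob_space_haar_site)

lemma measurable_prod_component:
  assumes "l < n" "x < d"
  shows "(\<lambda>\<phi>. \<phi> l x) \<in> borel_measurable (prod_measure d n)"
proof -
  have "(\<lambda>\<phi>. \<phi> l) \<in> prod_measure d n \<rightarrow>\<^sub>M haar_site d"
    unfolding prod_measure_def by (rule measurable_component_singleton) (use assms in simp)
  from measurable_compose[OF this measurable_haar_component[OF assms(2)]] show ?thesis .
qed

definition amplitude :: "nat \<Rightarrow> nat \<Rightarrow> (nat \<Rightarrow> nat \<Rightarrow> complex) \<Rightarrow> nat \<Rightarrow> complex" where
  "amplitude d n \<phi> i = (\<Prod>l<n. \<phi> l (digit d n i l))"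

lemma measurable_amplitude:
  "d > 0 \<Longrightarrow> (\<lambda>\<phi>. amplitude d n \<phi> i) \<in> borel_measurable (prod_measure d n)"
  unfolding amplitude_def
  by (intro borel_measurable_prod measurable_prod_component) (auto intro: digit_less)

lemma measurable_overlap:
  assumes "d > 0"
  shows "(\<lambda>\<phi>. (cmod (\<Sum>i<d ^ n. cnj (u i) * amplitude d n \<phi> i))\<^sup>2) \<in> borel_measurable (prod_measure d n)"
proof -
  note [measurable] = measurable_amplitude[OF assms, of n]
  show ?thesis by measurable
qed

text \<open>Independence of the sites factorises the expectation. Two different configurations
  differ at some site, and there the off-diagonal moment of one site is 0.\<close>

lemma amplitude_covariance:
  assumes d: "d > 0" and ij: "i < d ^ n" "j < d ^ n"
  shows "integrable (prod_measure d n) (\<lambda>\<phi>. amplitude d n \<phi> i * cnj (amplitude d n \<phi> j))"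
    and "(\<integral>\<phi>. amplitude d n \<phi> i * cnj (amplitude d n \<phi> j) \<partial>prod_measure d n) =
      (if i = j then of_real (\<Prod>l<n. \<integral>\<phi>. (cmod (\<phi> (digit d n i l)))\<^sup>2 \<partial>haar_site d) else 0)"
proof -
  interpret product_sigma_finite "\<lambda>_::nat. haar_site d"
    by unfold_locales (rule prob_space_imp_sigma_finite[OF prob_space_haar_site, THEN sigma_finite_measure.sigma_finite_countable])
  define f where "f = (\<lambda>l \<phi>. \<phi> (digit d n i l) * cnj (\<phi> (digit d n j l)))"
  have eq: "amplitude d n \<phi> i * cnj (amplitude d n \<phi> j) = (\<Prod>l<n. f l (\<phi> l))" for \<phi>
    by (simp add: amplitude_def f_def prod.distrib)
  have int: "integrable (haar_site d) (f l)" for l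
    unfolding f_def by (intro integrable_haar_product digit_less d)
  show "integrable (prod_measure d n) (\<lambda>\<phi>. amplitude d n \<phi> i * cnj (amplitude d n \<phi> j))"
    unfolding eq prod_measure_def by (rule product_integrable_prod) (simp_all add: int)
  have "(\<integral>\<phi>. amplitude d n \<phi> i * cnj (amplitude d n \<phi> j) \<partial>prod_measure d n) = (\<Prod>l<n. \<integral>\<phi>. f l \<phi> \<partial>haar_site d)"
    unfolding eq prod_measure_def by (rule product_integral_prod) (simp_all add: int)
  also have "\<dots> = (if i = j then of_real (\<Prod>l<n. \<integral>\<phi>. (cmod (\<phi> (digit d n i l)))\<^sup>2 \<partial>haar_site d) else 0)"
  proof (cases "i = j")
    case True
    have "(\<integral>\<phi>. f l \<phi> \<partial>haar_site d) = of_real (\<integral>\<phi>. (cmod (\<phi> (digit d n i l)))\<^sup>2 \<partial>haar_site d)" for l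
      unfolding f_def True integral_complex_of_real[symmetric] by (simp only: complex_norm_square)
    thus ?thesis using True by simp
  next
    case False
    then obtain l where l: "l < n" "digit d n i l \<noteq> digit d n j l"
      using digit_inject[OF ij] by blast
    have "(\<integral>\<phi>. f l \<phi> \<partial>haar_site d) = 0"
      unfolding f_def by (intro haar_off_diagonal digit_less d l)
    thus ?thesis using False l(1) by (auto intro!: prod_zero)
  qed
  finally show "(\<integral>\<phi>. amplitude d n \<phi> i * cnj (amplitude d n \<phi> j) \<partial>prod_measure d n) =
      (if i = j then of_real (\<Prod>l<n. \<integral>\<phi>. (cmod (\<phi> (digit d n i l)))\<^sup>2 \<partial>haar_site d) else 0)" .
qed

text \<open>The covariance matrix of the amplitudes is diagonal with entries at most (1 / d)^n, so
  no unit vector, however entangled, has a larger mean overlap with a random product state.\<close>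

lemma expectation_overlap:
  fixes u :: "nat \<Rightarrow> complex"
  assumes d: "d > 0" and u: "(\<Sum>i<d ^ n. (cmod (u i))\<^sup>2) = 1"
  shows "integrable (prod_measure d n) (\<lambda>\<phi>. (cmod (\<Sum>i<d ^ n. cnj (u i) * amplitude d n \<phi> i))\<^sup>2)"
    and "(\<integral>\<phi>. (cmod (\<Sum>i<d ^ n. cnj (u i) * amplitude d n \<phi> i))\<^sup>2 \<partial>prod_measure d n) \<le> 1 / real d ^ n"
proof -
  let ?N = "d ^ n" and ?P = "prod_measure d n"
  let ?p = "\<lambda>\<phi>. (cmod (\<Sum>i<?N. cnj (u i) * amplitude d n \<phi> i))\<^sup>2"
  define Q where "Q = (\<lambda>i. \<Prod>l<n. \<integral>\<phi>. (cmod (\<phi> (digit d n i l)))\<^sup>2 \<partial>haar_site d)"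
  have eq: "complex_of_real (?p \<phi>) = (\<Sum>i<?N. \<Sum>j<?N. cnj (u i) * u j * (amplitude d n \<phi> i * cnj (amplitude d n \<phi> j)))" for \<phi>
    unfolding complex_norm_square cnj_sum sum_product
    by (intro sum.cong refl) (simp add: mult_ac)
  have int1: "integrable ?P (\<lambda>\<phi>. cnj (u i) * u j * (amplitude d n \<phi> i * cnj (amplitude d n \<phi> j)))"
    if "i < ?N" "j < ?N" for i j
    by (intro Bochner_Integration.integrable_mult_right amplitude_covariance(1)[OF d] that)
  have int2: "integrable ?P (\<lambda>\<phi>. \<Sum>j<?N. cnj (u i) * u j * (amplitude d n \<phi> i * cnj (amplitude d n \<phi> j)))"
    if "i < ?N" for i
    by (intro Bochner_Integration.integrable_sum int1) (use that in auto)
  have int: "integrable ?P (\<lambda>\<phi>. \<Sum>i<?N. \<Sum>j<?N. cnj (u i) * u j * (amplitude d n \<phi> i * cnj (amplitude d n \<phi> j)))"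
    by (intro Bochner_Integration.integrable_sum int2) auto
  have "integrable ?P (\<lambda>\<phi>. complex_of_real (?p \<phi>))"
    unfolding eq by (rule int)
  thus int_p: "integrable ?P ?p" by (simp only: complex_of_real_integrable_eq)
  have "complex_of_real (\<integral>\<phi>. ?p \<phi> \<partial>?P) = (\<integral>\<phi>. complex_of_real (?p \<phi>) \<partial>?P)"
    by (rule integral_complex_of_real[symmetric])
  also have "\<dots> = (\<Sum>i<?N. \<integral>\<phi>. (\<Sum>j<?N. cnj (u i) * u j * (amplitude d n \<phi> i * cnj (amplitude d n \<phi> j))) \<partial>?P)"
    unfolding eq by (rule Bochner_Integration.integral_sum) (simp add: int2)
  also have "\<dots> = (\<Sum>i<?N. \<Sum>j<?N. \<integral>\<phi>. cnj (u i) * u j * (amplitude d n \<phi> i * cnj (amplitude d n \<phi> j)) \<partial>?P)"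
    by (rule sum.cong[OF refl], rule Bochner_Integration.integral_sum) (simp add: int1)
  also have "\<dots> = (\<Sum>i<?N. \<Sum>j<?N. cnj (u i) * u j * (\<integral>\<phi>. amplitude d n \<phi> i * cnj (amplitude d n \<phi> j) \<partial>?P))"
    by (simp only: integral_mult_right_zero)
  also have "\<dots> = (\<Sum>i<?N. \<Sum>j<?N. if j = i then complex_of_real ((cmod (u i))\<^sup>2 * Q i) else 0)"
    by (intro sum.cong refl)
      (auto simp: amplitude_covariance(2)[OF d] Q_def complex_norm_square mult.commute simp del: of_real_prod of_real_power)
  also have "\<dots> = complex_of_real (\<Sum>i<?N. (cmod (u i))\<^sup>2 * Q i)" by simp
  finally have "(\<integral>\<phi>. ?p \<phi> \<partial>?P) = (\<Sum>i<?N. (cmod (u i))\<^sup>2 * Q i)" by (simp only: of_real_eq_iff)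
  also have "\<dots> \<le> (\<Sum>i<?N. (cmod (u i))\<^sup>2 * (1 / d) ^ n)"
  proof (intro sum_mono mult_left_mono)
    fix i
    have "Q i \<le> (\<Prod>l<n. 1 / d)"
      unfolding Q_def by (intro prod_mono conjI haar_diagonal digit_less d Bochner_Integration.integral_nonneg) simp
    thus "Q i \<le> (1 / d) ^ n" by simp
  qed simp
  also have "\<dots> = 1 / real d ^ n"
    unfolding sum_distrib_right[symmetric] u by (simp add: power_one_over)
  finally show "(\<integral>\<phi>. ?p \<phi> \<partial>?P) \<le> 1 / real d ^ n" .
qed

text \<open>The squared norm of a product state is the product of those of its sites.\<close>

lemma AE_amplitude_norm:
  assumes d: "d > 0"
  shows "AE \<phi> in prod_measure d n. (\<Sum>i<d ^ n. (cmod (amplitude d n \<phi> i))\<^sup>2) \<le> 1"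
proof -
  have "AE \<phi> in prod_measure d n. (\<Sum>x<d. (cmod (\<phi> l x))\<^sup>2) \<le> 1" if "l \<in> {..<n}" for l
    unfolding prod_measure_def
    by (rule AE_PiM_component[OF prob_space_haar_site that AE_haar_site_norm])
  hence "AE \<phi> in prod_measure d n. \<forall>l\<in>{..<n}. (\<Sum>x<d. (cmod (\<phi> l x))\<^sup>2) \<le> 1"
    by (intro AE_finite_allI) auto
  thus ?thesis
  proof eventually_elim
    case (elim \<phi>)
    have "(\<Sum>i<d ^ n. (cmod (amplitude d n \<phi> i))\<^sup>2) = (\<Sum>i<d ^ n. \<Prod>l<n. (cmod (\<phi> l (digit d n i l)))\<^sup>2)"
      by (simp add: amplitude_def prod_power_distrib flip: prod_norm)
    also have "\<dots> = (\<Prod>l<n. \<Sum>x<d. (cmod (\<phi> l x))\<^sup>2)" by (rule sum_prod_digits[OF d])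
    also have "\<dots> \<le> 1" using elim by (intro prod_le_1) (auto intro: sum_nonneg)
    finally show ?case .
  qed
qed

text \<open>The four numbers \<open>Re (c * z)\<close> are plus and minus the real and imaginary
  parts, and |z| is at most the sum of their moduli, so one reaches half of \<delta>.\<close>

lemma cmod_ge_imp_direction:
  assumes "cmod z \<ge> \<delta>"
  shows "\<exists>c\<in>{1, -1, \<i>, -\<i>}. Re (c * z) \<ge> \<delta> / 2"
proof -
  have "\<delta> \<le> \<bar>Re z\<bar> + \<bar>Im z\<bar>" using assms cmod_le[of z] by linarith
  thus ?thesis by (auto simp: abs_if split: if_splits)
qed

text \<open>From t < exp t, applied with both signs to the real and imaginary parts. It turns
  exponential moments into a first moment without integrating a tail.\<close>

lemma cmod_le_exp_directions:
  assumes "x > 0"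
  shows "cmod z \<le> (\<Sum>c\<in>{1, -1, \<i>, -\<i>}. exp (x * Re (c * z))) / x"
proof -
  have "x * \<bar>t\<bar> \<le> exp (x * t) + exp (- (x * t))" for t :: real
  proof -
    have "x * \<bar>t\<bar> = \<bar>x * t\<bar>" using assms by (simp add: abs_mult)
    thus ?thesis
      using exp_ge_add_one_self[of "x * t"] exp_ge_add_one_self[of "- (x * t)"] exp_gt_zero[of "x * t"]
        exp_gt_zero[of "- (x * t)"] by linarith
  qed
  from this[of "Re z"] this[of "Im z"]
  have "x * cmod z \<le> exp (x * Re z) + exp (- (x * Re z)) + (exp (x * Im z) + exp (- (x * Im z)))"
    using mult_left_mono[OF cmod_le[of z], of x] assms by (simp add: distrib_left)
  also have "\<dots> = (\<Sum>c\<in>{1, -1, \<i>, -\<i>}. exp (x * Re (c * z)))"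
    by (simp add: complex_eq_iff)
  finally show ?thesis using assms by (simp add: field_simps)
qed

text \<open>The weights enter linearly once Jensen has moved the exponential inside the mixture.
  Taking expectations then replaces them by at most the uniform weights 1 / N, for which
  \<open>sg\<close> is available; the weights need not be independent of each other.\<close>

lemma (in prob_space) random_mixture_bounds:
  fixes p :: "nat \<Rightarrow> 'a \<Rightarrow> real" and a :: "nat \<Rightarrow> complex"
  assumes int: "\<And>k. k < N \<Longrightarrow> integrable M (p k)"
    and mean: "\<And>k. k < N \<Longrightarrow> expectation (p k) \<le> 1 / N"
    and nonneg: "\<And>k \<omega>. p k \<omega> \<ge> 0"
    and sub: "AE \<omega> in M. (\<Sum>k<N. p k \<omega>) \<le> 1"
    and sg: "\<And>c x. cmod c = 1 \<Longrightarrow> (\<Sum>k<N. exp (x * Re (c * a k))) \<le> N * exp (x\<^sup>2 * V)"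
    and N: "N > 0" and V: "V > 0"
  defines "Z \<equiv> \<lambda>\<omega>. \<Sum>k<N. of_real (p k \<omega>) * a k"
  shows "expectation (\<lambda>\<omega>. cmod (Z \<omega>)) \<le> 4 * exp 1 * sqrt V"
    and "\<delta> \<ge> 0 \<Longrightarrow> prob {\<omega> \<in> space M. cmod (Z \<omega>) \<ge> \<delta>} \<le> 8 * exp (- \<delta>\<^sup>2 / (16 * V))"
proof -
  have [measurable]: "p k \<in> borel_measurable M" if "k < N" for k using int[OF that] by simp
  have meas [measurable]: "Z \<in> borel_measurable M" unfolding Z_def by measurable
  have intZ: "integrable M Z"
    unfolding Z_def by (intro Bochner_Integration.integrable_sum integrable_mult_left integrable_of_real int) auto
  have "expectation (\<lambda>\<omega>. cmod (Z \<omega>)) \<le> expectation (\<lambda>\<omega>. \<Sum>k<N. p k \<omega> * cmod (a k))"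
  proof (intro integral_mono)
    show "integrable M (\<lambda>\<omega>. cmod (Z \<omega>))" using intZ by simp
    show "integrable M (\<lambda>\<omega>. \<Sum>k<N. p k \<omega> * cmod (a k))"
      by (intro Bochner_Integration.integrable_sum integrable_mult_left int) auto
    show "cmod (Z \<omega>) \<le> (\<Sum>k<N. p k \<omega> * cmod (a k))" for \<omega>
      unfolding Z_def by (rule order_trans[OF norm_sum]) (simp add: norm_mult nonneg)
  qed
  also have "\<dots> = (\<Sum>k<N. expectation (p k) * cmod (a k))"
    by (subst Bochner_Integration.integral_sum) (auto intro: integrable_mult_left int)
  also have "\<dots> \<le> (\<Sum>k<N. 1 / N * cmod (a k))"
    by (intro sum_mono mult_right_mono mean) auto
  \<comment> \<open>The choice x = 1 / sqrt V makes x^2 V = 1, whence the factor exp 1, four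
    times.\<close>
  also have "\<dots> \<le> (\<Sum>k<N. 1 / N * ((\<Sum>c\<in>{1, -1, \<i>, -\<i>}. exp (1 / sqrt V * Re (c * a k))) / (1 / sqrt V)))"
    using V by (intro sum_mono mult_left_mono cmod_le_exp_directions) auto
  also have "\<dots> = sqrt V / N * (\<Sum>k<N. \<Sum>c\<in>{1, -1, \<i>, -\<i>}. exp (1 / sqrt V * Re (c * a k)))"
  proof (subst sum_distrib_left, rule sum.cong[OF refl])
    show "1 / N * (S k / (1 / sqrt V)) = sqrt V / N * S k" for S :: "nat \<Rightarrow> real" and k by simp
  qed
  also have "(\<Sum>k<N. \<Sum>c\<in>{1, -1, \<i>, -\<i>}. exp (1 / sqrt V * Re (c * a k)))
      = (\<Sum>c\<in>{1, -1, \<i>, -\<i>}. \<Sum>k<N. exp (1 / sqrt V * Re (c * a k)))" by (rule sum.swap)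
  also have "sqrt V / N * \<dots> \<le> sqrt V / N * (\<Sum>c\<in>{1, -1, \<i>, -\<i>}. N * exp ((1 / sqrt V)\<^sup>2 * V))"
    using V by (intro mult_left_mono sum_mono sg) auto
  also have "\<dots> = 4 * exp 1 * sqrt V"
    using V N by (simp add: complex_eq_iff power_divide)
  finally show "expectation (\<lambda>\<omega>. cmod (Z \<omega>)) \<le> 4 * exp 1 * sqrt V" .

  assume \<delta>: "\<delta> \<ge> 0"
  have dir: "prob {\<omega> \<in> space M. Re (c * Z \<omega>) \<ge> \<delta> / 2} \<le> 2 * exp (- \<delta>\<^sup>2 / (16 * V))" if c: "cmod c = 1" for c
  proof -
    let ?S = "{\<omega> \<in> space M. Re (c * Z \<omega>) \<ge> \<delta> / 2}"
    \<comment> \<open>The minimiser of the Chernoff exponent x^2 V - x \<delta> / 2, with minimum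
      -\<delta>^2 / (16 V).\<close>
    define x where "x = \<delta> / (4 * V)"
    have x: "x \<ge> 0" using \<delta> V by (simp add: x_def)
    have "AE \<omega> in M. indicator ?S \<omega> * exp (x * (\<delta> / 2)) \<le> (\<Sum>k<N. p k \<omega> * exp (x * Re (c * a k))) + 1"
      using sub
    proof eventually_elim
      case (elim \<omega>)
      have nn: "0 \<le> (\<Sum>k<N. p k \<omega> * exp (x * Re (c * a k)))" by (intro sum_nonneg) (simp add: nonneg)
      show ?case
      proof (cases "\<omega> \<in> ?S")
        case True
        hence "\<delta> / 2 \<le> Re (c * Z \<omega>)" by blast
        from mult_left_mono[OF this x] have "exp (x * (\<delta> / 2)) \<le> exp (x * Re (c * Z \<omega>))"
          by (simp only: exp_le_cancel_iff)
        also have "x * Re (c * Z \<omega>) = (\<Sum>k<N. p k \<omega> * (x * Re (c * a k)))"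
          unfolding Z_def sum_distrib_left Re_sum by (intro sum.cong refl) (simp add: algebra_simps)
        also have "exp \<dots> \<le> (\<Sum>k<N. p k \<omega> * exp (x * Re (c * a k))) + (1 - (\<Sum>k<N. p k \<omega>))"
          using elim nonneg by (intro exp_jensen) auto
        \<comment> \<open>The missing mass is bounded by 1, which below is at most exp (x^2 V) and
          so doubles the final bound.\<close>
        also have "\<dots> \<le> (\<Sum>k<N. p k \<omega> * exp (x * Re (c * a k))) + 1"
          using nonneg by (simp add: sum_nonneg)
        finally show ?thesis using True by simp
      qed (use nn in simp)
    qed
    hence "expectation (\<lambda>\<omega>. indicator ?S \<omega> * exp (x * (\<delta> / 2)))
        \<le> expectation (\<lambda>\<omega>. (\<Sum>k<N. p k \<omega> * exp (x * Re (c * a k))) + 1)"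
      by (intro integral_mono_AE Bochner_Integration.integrable_add Bochner_Integration.integrable_sum
          integrable_mult_left int) (auto simp: emeasure_eq_measure)
    also have "\<dots> = expectation (\<lambda>\<omega>. \<Sum>k<N. p k \<omega> * exp (x * Re (c * a k))) + expectation (\<lambda>_. 1)"
      by (intro Bochner_Integration.integral_add Bochner_Integration.integrable_sum integrable_mult_left int) auto
    also have "expectation (\<lambda>\<omega>. \<Sum>k<N. p k \<omega> * exp (x * Re (c * a k)))
        = (\<Sum>k<N. expectation (p k) * exp (x * Re (c * a k)))"
      by (subst Bochner_Integration.integral_sum) (auto intro: integrable_mult_left int)
    also have "expectation (\<lambda>_. 1) = (1 :: real)" by (simp add: prob_space)
    also have "(\<Sum>k<N. expectation (p k) * exp (x * Re (c * a k))) + 1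
        \<le> (\<Sum>k<N. 1 / N * exp (x * Re (c * a k))) + 1"
      by (intro add_right_mono sum_mono mult_right_mono mean) auto
    also have "\<dots> = 1 / N * (\<Sum>k<N. exp (x * Re (c * a k))) + 1" by (simp only: sum_distrib_left)
    also have "\<dots> \<le> 1 / N * (N * exp (x\<^sup>2 * V)) + 1"
      by (intro add_right_mono mult_left_mono sg c) auto
    also have "\<dots> \<le> 2 * exp (x\<^sup>2 * V)" using N V by simp
    finally have "prob ?S * exp (x * (\<delta> / 2)) \<le> 2 * exp (x\<^sup>2 * V)" by simp
    hence "prob ?S \<le> 2 * exp (x\<^sup>2 * V) / exp (x * (\<delta> / 2))"
      by (simp only: pos_le_divide_eq[OF exp_gt_zero])
    also have "\<dots> = 2 * exp (x\<^sup>2 * V - x * (\<delta> / 2))" by (simp only: exp_diff times_divide_eq_right)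
    also have "x\<^sup>2 * V - x * (\<delta> / 2) = - \<delta>\<^sup>2 / (16 * V)"
      using V by (simp add: x_def field_simps power2_eq_square)
    finally show ?thesis .
  qed
  have "{\<omega> \<in> space M. cmod (Z \<omega>) \<ge> \<delta>} \<subseteq> (\<Union>c\<in>{1, -1, \<i>, -\<i>}. {\<omega> \<in> space M. Re (c * Z \<omega>) \<ge> \<delta> / 2})"
    using cmod_ge_imp_direction by blast
  hence "prob {\<omega> \<in> space M. cmod (Z \<omega>) \<ge> \<delta>}
      \<le> prob (\<Union>c\<in>{1, -1, \<i>, -\<i>}. {\<omega> \<in> space M. Re (c * Z \<omega>) \<ge> \<delta> / 2})"
    by (intro finite_measure_mono) auto
  also have "\<dots> \<le> (\<Sum>c\<in>{1, -1, \<i>, -\<i>}. prob {\<omega> \<in> space M. Re (c * Z \<omega>) \<ge> \<delta> / 2})"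
    by (intro finite_measure_subadditive_finite) auto
  also have "\<dots> \<le> (\<Sum>c\<in>{1, -1, \<i>, -\<i>}. 2 * exp (- \<delta>\<^sup>2 / (16 * V)))"
    by (intro sum_mono dir) auto
  also have "\<dots> = 8 * exp (- \<delta>\<^sup>2 / (16 * V))" by (simp add: complex_eq_iff)
  finally show "prob {\<omega> \<in> space M. cmod (Z \<omega>) \<ge> \<delta>} \<le> 8 * exp (- \<delta>\<^sup>2 / (16 * V))" .
qed

section \<open>Constants and the two bounds for the time average\<close>

theorem theorem3:
  fixes d r :: nat and M :: real
  assumes "d \<ge> 2" and "r \<ge> 1" and "M > 0"
  shows "\<exists>C1 C2 c :: real. C1 > 0 \<and> C2 > 0 \<and> c > 0 \<and>
    (\<exists>N. \<forall>n \<ge> N. \<forall>H A :: complex mat.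
       H \<in> carrier_mat (d ^ n) (d ^ n) \<and> hermitian_mat H \<and>
       H * transl d n = transl d n * H \<and> nondegenerate_spectrum H \<and>
       A \<in> carrier_mat (d ^ n) (d ^ n) \<and> mat_trace A = 0 \<and> r_local d n r A \<and>
       op_norm A \<le> M
       \<longrightarrow>
       (\<lambda>\<phi>. time_avg H A (prod_state d n \<phi>)) \<in> borel_measurable (prod_measure d n) \<and>
       (\<integral>\<phi>. cmod (time_avg H A (prod_state d n \<phi>)) \<partial>prod_measure d n) \<le> C1 / sqrt (real n) \<and>
       (\<forall>\<delta>. \<delta> \<ge> C2 * sqrt (ln (real n) / real n) \<longrightarrow>
          measure (prod_measure d n)
            {\<phi> \<in> space (prod_measure d n). cmod (time_avg H A (prod_state d n \<phi>)) \<ge> \<delta>}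
          \<le> exp (- c * real n * \<delta>\<^sup>2)))"
proof -
  \<comment> \<open>Bounds the eigenvalues of the Hermitian part of \<open>A\<close> on one block,
    of dimension d^r.\<close>
  define B where "B = real d ^ (2 * r) * M"
  have d: "d > 0" and r: "r > 0" and B: "B > 0" using assms by (auto simp: B_def)
  \<comment> \<open>With V = 2 r B^2 / n: C1 is 4 e sqrt (n V), \<open>c\<close> is half of 1 / (16
    n V), and C2 is chosen so that c C2^2 = 3, as 8 <= exp 3.\<close>
  define C1 where "C1 = 4 * exp 1 * (sqrt (2 * r) * B)"
  define C2 where "C2 = sqrt (192 * r) * B"
  define c where "c = 1 / (64 * r * B\<^sup>2)"
  have pos: "C1 > 0" "C2 > 0" "c > 0" using r B by (simp_all add: C1_def C2_def c_def)
  \<comment> \<open>The bound \<open>r\<close> on \<open>n\<close> guarantees a full block; the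
    bound 3 gives ln n >= 1, because e <= 3.\<close>
  have main: "(\<lambda>\<phi>. time_avg H A (prod_state d n \<phi>)) \<in> borel_measurable (prod_measure d n) \<and>
       (\<integral>\<phi>. cmod (time_avg H A (prod_state d n \<phi>)) \<partial>prod_measure d n) \<le> C1 / sqrt (real n) \<and>
       (\<forall>\<delta>. \<delta> \<ge> C2 * sqrt (ln (real n) / real n) \<longrightarrow>
          measure (prod_measure d n)
            {\<phi> \<in> space (prod_measure d n). cmod (time_avg H A (prod_state d n \<phi>)) \<ge> \<delta>}
          \<le> exp (- c * real n * \<delta>\<^sup>2))"
    if n: "n \<ge> max 3 r"
      and H: "H \<in> carrier_mat (d ^ n) (d ^ n)" "hermitian_mat H" "H * transl d n = transl d n * H"
        "nondegenerate_spectrum H"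
      and A: "A \<in> carrier_mat (d ^ n) (d ^ n)" "mat_trace A = 0" "r_local d n r A" "op_norm A \<le> M"
    for n and H A :: "complex mat"
  proof -
    let ?N = "d ^ n" and ?P = "prod_measure d n"
    interpret prob_space ?P by (rule prob_space_prod_measure)
    have "\<forall>i<?N. \<forall>j<?N. H $$ (j, i) = cnj (H $$ (i, j))"
      using H(2) unfolding hermitian_mat_def carrier_matD(1)[OF H(1)] carrier_matD(2)[OF H(1)] by blast
    hence herm: "H $$ (j, i) = cnj (H $$ (i, j))" if "i < ?N" "j < ?N" for i j
      using that by blast
    obtain u eig where sd: "spectral_decomposition ?N (\<lambda>i j. H $$ (i, j)) u eig"
      by (rule hermitian_spectral_theorem[of ?N "\<lambda>i j. H $$ (i, j)"]) (rule herm that; assumption)+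
    note ob = spectral_decomposition_basis[OF sd]
    have inj: "inj_on eig {..<?N}" by (rule nondegenerate_spectrum_inj[OF H(1) H(4) sd])
    define p where "p = (\<lambda>k \<phi>. (cmod (\<Sum>i<?N. cnj (u k i) * amplitude d n \<phi> i))\<^sup>2)"
    define a where "a = (\<lambda>k. quad_form ?N (u k) (\<lambda>i j. A $$ (i, j)))"
    have avg: "time_avg H A (prod_state d n \<phi>) = (\<Sum>k<?N. of_real (p k \<phi>) * a k)" for \<phi>
      using time_avg_spectral[OF H(1) A(1) sd inj, of "prod_state d n \<phi>"]
      by (simp add: p_def a_def quad_form_def prod_state_def amplitude_def)
    \<comment> \<open>The factor 2 pays for the rounding in \<open>n div r\<close>: once there is a
      full block, n < r m + r <= 2 r m with m = \<open>n div r\<close>.\<close>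
    define V where "V = 2 * r * B\<^sup>2 / n"
    have n0: "real n > 0" using n by simp
    have V: "V > 0" using r B n0 by (simp add: V_def)
    have m: "B\<^sup>2 / real (n div r) \<le> V"
    proof -
      have m0: "0 < n div r" using n r by (simp add: div_greater_zero_iff)
      have "n < r * (n div r) + r"
        using mult_div_mod_eq[of r n] mod_less_divisor[OF r, of n] by linarith
      also have "\<dots> \<le> r * (n div r) + r * (n div r)" using m0 by simp
      finally have "n \<le> 2 * r * (n div r)" by simp
      hence "real n \<le> real (2 * r * (n div r))" by (simp only: of_nat_le_iff)
      hence "real n \<le> 2 * real r * real (n div r)" by (simp only: of_nat_mult of_nat_numeral)
      hence "B\<^sup>2 * real n \<le> B\<^sup>2 * (2 * real r * real (n div r))" by (rule mult_left_mono) simp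
      thus ?thesis using m0 n0 by (simp add: V_def divide_simps mult_ac)
    qed
    have sg: "(\<Sum>k<?N. exp (x * Re (c * a k))) \<le> real ?N * exp (x\<^sup>2 * V)" if "cmod c = 1" for c x
    proof -
      have "(\<Sum>k<?N. exp (x * Re (c * a k))) \<le> real ?N * exp (x\<^sup>2 * B\<^sup>2 / real (n div r))"
        using sum_exp_diagonal_le[OF d r _ H(1,3) sd inj A that, of x] n by (simp add: a_def B_def)
      also have "x\<^sup>2 * B\<^sup>2 / real (n div r) \<le> x\<^sup>2 * V"
        using mult_left_mono[OF m, of "x\<^sup>2"] by simp
      finally show ?thesis using d by simp
    qed
    have u1: "(\<Sum>i<?N. (cmod (u k i))\<^sup>2) = 1" if "k < ?N" for k
      by (rule sum_cmod_square_basis[OF ob that])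
    have int: "integrable ?P (p k)" and mean: "expectation (p k) \<le> 1 / real ?N" if "k < ?N" for k
      using expectation_overlap[OF d u1[OF that]] by (simp_all add: p_def)
    have sub: "AE \<phi> in ?P. (\<Sum>k<?N. p k \<phi>) \<le> 1"
      using AE_amplitude_norm[OF d, of n] by (simp add: p_def sum_overlaps[OF ob])
    have p0: "p k \<phi> \<ge> 0" for k \<phi> by (simp add: p_def)
    have N0: "?N > 0" using d by simp
    note bounds = random_mixture_bounds[where p = p and a = a and N = ?N and V = V]
    have "(\<lambda>\<phi>. time_avg H A (prod_state d n \<phi>)) \<in> borel_measurable ?P"
      unfolding avg p_def
      by (intro borel_measurable_sum borel_measurable_times measurable_compose[OF measurable_overlap[OF d]
            borel_measurable_of_real] borel_measurable_const)
    moreover have "expectation (\<lambda>\<phi>. cmod (time_avg H A (prod_state d n \<phi>))) \<le> C1 / sqrt (real n)"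
    proof -
      have "expectation (\<lambda>\<phi>. cmod (time_avg H A (prod_state d n \<phi>))) \<le> 4 * exp 1 * sqrt V"
        unfolding avg by (rule bounds(1)) (fact int mean p0 sub N0 V | rule sg, assumption)+
      also have "\<dots> = C1 / sqrt (real n)"
        using B by (simp add: V_def C1_def real_sqrt_divide real_sqrt_mult)
      finally show ?thesis .
    qed
    moreover have "prob {\<phi> \<in> space ?P. cmod (time_avg H A (prod_state d n \<phi>)) \<ge> \<delta>} \<le> exp (- c * real n * \<delta>\<^sup>2)"
      if \<delta>: "\<delta> \<ge> C2 * sqrt (ln (real n) / real n)" for \<delta>
    proof -
      have "exp 1 \<le> real n" using exp_le n by simp
      hence ln: "1 \<le> ln (real n)" using n0 by (simp add: ln_ge_iff)
      have rhs0: "0 \<le> C2 * sqrt (ln (real n) / real n)" using pos(2) ln n0 by simp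
      hence \<delta>0: "0 \<le> \<delta>" using \<delta> by linarith
      have "C2\<^sup>2 * (ln (real n) / real n) = (C2 * sqrt (ln (real n) / real n))\<^sup>2"
        using ln n0 by (simp add: power_mult_distrib)
      also have "\<dots> \<le> \<delta>\<^sup>2" by (rule power_mono[OF \<delta> rhs0])
      finally have "C2\<^sup>2 * ln (real n) \<le> real n * \<delta>\<^sup>2" using n0 by (simp add: field_simps)
      moreover have "C2\<^sup>2 * 1 \<le> C2\<^sup>2 * ln (real n)" using ln by (intro mult_left_mono) auto
      ultimately have "192 * r * B\<^sup>2 \<le> real n * \<delta>\<^sup>2" by (simp add: C2_def power_mult_distrib)
      hence "3 \<le> c * real n * \<delta>\<^sup>2" using r B by (simp add: c_def field_simps)
      hence "exp (real 3 * 1) \<le> exp (c * real n * \<delta>\<^sup>2)" by simp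
      hence "exp 1 ^ 3 \<le> exp (c * real n * \<delta>\<^sup>2)" by (simp only: exp_of_nat_mult)
      moreover have "(2::real) ^ 3 \<le> exp 1 ^ 3"
        using exp_ge_add_one_self[of 1] by (intro power_mono) auto
      ultimately have 8: "8 \<le> exp (c * real n * \<delta>\<^sup>2)" by simp
      have "prob {\<phi> \<in> space ?P. cmod (time_avg H A (prod_state d n \<phi>)) \<ge> \<delta>} \<le> 8 * exp (- \<delta>\<^sup>2 / (16 * V))"
        unfolding avg by (rule bounds(2)) (fact int mean p0 sub N0 V \<delta>0 | rule sg, assumption)+
      \<comment> \<open>The exponent is split into two equal halves: one cancels the prefactor 8,
        the other is the claimed bound.\<close>
      also have "- \<delta>\<^sup>2 / (16 * V) = - (c * real n * \<delta>\<^sup>2) + - (c * real n * \<delta>\<^sup>2)"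
        using r B n0 by (simp add: V_def c_def field_simps)
      also have "8 * exp (- (c * real n * \<delta>\<^sup>2) + - (c * real n * \<delta>\<^sup>2))
          \<le> exp (c * real n * \<delta>\<^sup>2) * exp (- (c * real n * \<delta>\<^sup>2) + - (c * real n * \<delta>\<^sup>2))"
        using 8 by (intro mult_right_mono) auto
      also have "\<dots> = exp (- c * real n * \<delta>\<^sup>2)" by (simp flip: exp_add)
      finally show ?thesis .
    qed
    ultimately show ?thesis by blast
  qed
  show ?thesis
    by (intro exI[of _ C1] exI[of _ C2] exI[of _ c] conjI[OF pos(1)] conjI[OF pos(2)] conjI[OF pos(3)]
        exI[of _ "max 3 r"]) (intro allI impI, elim conjE, rule main)
qed

end
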